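(* Suppose that $\Phi$ is a continuously differentiable strictly convex $N$-function belonging to $\Delta_2(0)\cap\nabla_2(0)$. Let $G$ be a finitely generated group acting on a countable set $X$. Then for every $f\in D^\Phi(X)$ there exists a decomposition $f=u+h$, where $u\in(\overline{\ell^\Phi(X)})_{D^\Phi(X)}$ and $h\in HD^\Phi(X)$. It is unique up to an element of $D^\Phi(X)^G$.
   Context: An $N$-function is a function $\Phi:\mathbb{R}\to\mathbb{R}$ of the form $\Phi(x)=\int_0^{|x|}\varphi(t)\,dt$, where $\varphi$ is defined for $t\ge 0$, non-decreasing, right-continuous, $\varphi(0)=0$, $\varphi(t)>0$ for $t>0$, and $\lim_{t\to\infty}\varphi(t)=\infty$. $\Phi\in\Delta_2(0)$ means: there are $x_0>0$ and $K>2$ with $\Phi(2x)\le K\Phi(x)$ for $0\le x\le x_0$. $\Phi\in\nabla_2(0)$ means: there are $x_0>0$ and $c>1$ with $\Phi(x)\le\frac{1}{2c}\Phi(cx)$ for $0\le x\le x_0$. $\Phi'$ denotes the derivative of $\Phi$ on $\mathbb{R}$ (an odd function, equal to $\varphi$ on $[0,\infty)$). For a countable set $X$ and $f:X\to\mathbb{R}$ put $\rho_\Phi(f)=\sum_{x\in X}\Phi(f(x))$. The Orlicz space is $\ell^\Phi(X)=\{f:X\to\mathbb{R} : \rho_\Phi(af)<\infty \text{ for some } a>0\}$, equipped with the gauge norm $\|f\|_{(\Phi)}=\inf\{k>0 : \rho_\Phi(f/k)\le 1\}$. Let $S$ be a finite generating set of $G$. For $g\in G$ and $f:X\to\mathbb{R}$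 put $(\lambda_X(g)f)(x)=f(g^{-1}x)$. The space of $\Phi$-Dirichlet finite functions is $D^\Phi(X)=\{f:X\to\mathbb{R} : \lambda_X(g)f-f\in\ell^\Phi(X)\text{ for all } g\in G\}$ (equivalently, for all $g\in S$); it contains $\ell^\Phi(X)$. It carries the seminorm $f\mapsto\sum_{s\in S}\|\lambda_X(s)f-f\|_{(\Phi)}$, whose kernel $D^\Phi(X)^G$ is the space of functions in $D^\Phi(X)$ constant on the $G$-orbits of $X$. $(\overline{\ell^\Phi(X)})_{D^\Phi(X)}$ is the closure of $\ell^\Phi(X)$ in $D^\Phi(X)$ with respect to this seminorm. The $\Phi$-Laplacian of $f:X\to\mathbb{R}$ is $(\Delta_\Phi f)(x)=\sum_{s\in S}\Phi'(f(s^{-1}x)-f(x))$. A function $f\in D^\Phi(X)$ is $\Phi$-harmonic if $(\Delta_\Phi f)(x)=0$ for all $x\in X$; $HD^\Phi(X)$ is the set of $\Phi$-harmonic functions on $X$.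
   Formalization: The finite generating set S is assumed symmetric (closed under inverses); for a non-symmetric S, such as {a,b} in the free group F(a,b) acting on two copies of Z glued at 0, uniqueness of the decomposition fails. *)

theory Defs
  imports "HOL-Analysis.Analysis" "HOL-Algebra.Generated_Groups" "HOL-Algebra.Group_Action"
begin

definition N_function :: "(real \<Rightarrow> real) \<Rightarrow> bool" where
  "N_function \<Phi> \<longleftrightarrow> (\<exists>\<phi>::real \<Rightarrow> real.
     mono_on {0..} \<phi> \<and>
     (\<forall>t\<ge>0. continuous (at_right t) \<phi>) \<and>
     \<phi> 0 = 0 \<and>
     (\<forall>t>0. \<phi> t > 0) \<and>
     filterlim \<phi> at_top at_top \<and>
     (\<forall>x. (\<phi> has_integral \<Phi> x) {0..\<bar>x\<bar>}))"

definition Delta2_zero :: "(real \<Rightarrow> real) \<Rightarrow> bool" where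
  "Delta2_zero \<Phi> \<longleftrightarrow> (\<exists>x0>0. \<exists>K>2. \<forall>x. 0 \<le> x \<and> x \<le> x0 \<longrightarrow> \<Phi> (2 * x) \<le> K * \<Phi> x)"

definition Nabla2_zero :: "(real \<Rightarrow> real) \<Rightarrow> bool" where
  "Nabla2_zero \<Phi> \<longleftrightarrow>
     (\<exists>x0>0. \<exists>c>1. \<forall>x. 0 \<le> x \<and> x \<le> x0 \<longrightarrow> \<Phi> x \<le> 1 / (2 * c) * \<Phi> (c * x))"

definition strictly_convex :: "(real \<Rightarrow> real) \<Rightarrow> bool" where
  "strictly_convex \<Phi> \<longleftrightarrow> (\<forall>x y t. x \<noteq> y \<and> 0 < t \<and> t < 1 \<longrightarrow>
     \<Phi> ((1 - t) * x + t * y) < (1 - t) * \<Phi> x + t * \<Phi> y)"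

text \<open>
  Functions on the set \<open>X\<close> are represented by total functions of which only the values on \<open>X\<close>
  matter: every notion below is invariant under changing a function outside \<open>X\<close>.
  The modular takes values in \<open>[0, \<infinity>]\<close>; N-functions are nonnegative, so \<open>ennreal\<close> does not
  truncate.
\<close>

definition modular :: "(real \<Rightarrow> real) \<Rightarrow> 'x set \<Rightarrow> ('x \<Rightarrow> real) \<Rightarrow> ennreal" where
  "modular \<Phi> X f = (\<Sum>\<^sub>\<infinity>x\<in>X. ennreal (\<Phi> (f x)))"

definition Orlicz_space :: "(real \<Rightarrow> real) \<Rightarrow> 'x set \<Rightarrow> ('x \<Rightarrow> real) set" where
  "Orlicz_space \<Phi> X = {f. \<exists>a>0. modular \<Phi> X (\<lambda>x. a * f x) < \<infinity>}"

definition gauge_norm :: "(real \<Rightarrow> real) \<Rightarrow> 'x set \<Rightarrow> ('x \<Rightarrow> real) \<Rightarrow> real" where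
  "gauge_norm \<Phi> X f = Inf {k. k > 0 \<and> modular \<Phi> X (\<lambda>x. f x / k) \<le> 1}"

definition translate ::
  "('g, 'm) monoid_scheme \<Rightarrow> ('g \<Rightarrow> 'x \<Rightarrow> 'x) \<Rightarrow> 'g \<Rightarrow> ('x \<Rightarrow> real) \<Rightarrow> 'x \<Rightarrow> real" where
  "translate G \<alpha> g f = (\<lambda>x. f (\<alpha> (inv\<^bsub>G\<^esub> g) x))"

definition Dirichlet_space ::
  "(real \<Rightarrow> real) \<Rightarrow> ('g, 'm) monoid_scheme \<Rightarrow> 'x set \<Rightarrow> ('g \<Rightarrow> 'x \<Rightarrow> 'x) \<Rightarrow> ('x \<Rightarrow> real) set" where
  "Dirichlet_space \<Phi> G X \<alpha> =
     {f. \<forall>g\<in>carrier G. (\<lambda>x. translate G \<alpha> g f x - f x) \<in> Orlicz_space \<Phi> X}"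

definition Dirichlet_seminorm ::
  "(real \<Rightarrow> real) \<Rightarrow> ('g, 'm) monoid_scheme \<Rightarrow> 'g set \<Rightarrow> 'x set \<Rightarrow> ('g \<Rightarrow> 'x \<Rightarrow> 'x)
    \<Rightarrow> ('x \<Rightarrow> real) \<Rightarrow> real" where
  "Dirichlet_seminorm \<Phi> G S X \<alpha> f =
     (\<Sum>s\<in>S. gauge_norm \<Phi> X (\<lambda>x. translate G \<alpha> s f x - f x))"

definition Dirichlet_invariants ::
  "(real \<Rightarrow> real) \<Rightarrow> ('g, 'm) monoid_scheme \<Rightarrow> 'x set \<Rightarrow> ('g \<Rightarrow> 'x \<Rightarrow> 'x) \<Rightarrow> ('x \<Rightarrow> real) set" where
  "Dirichlet_invariants \<Phi> G X \<alpha> =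
     {f \<in> Dirichlet_space \<Phi> G X \<alpha>. \<forall>Y\<in>orbits G X \<alpha>. f constant_on Y}"

definition Orlicz_closure ::
  "(real \<Rightarrow> real) \<Rightarrow> ('g, 'm) monoid_scheme \<Rightarrow> 'g set \<Rightarrow> 'x set \<Rightarrow> ('g \<Rightarrow> 'x \<Rightarrow> 'x)
    \<Rightarrow> ('x \<Rightarrow> real) set" where
  "Orlicz_closure \<Phi> G S X \<alpha> =
     {u \<in> Dirichlet_space \<Phi> G X \<alpha>. \<forall>\<epsilon>>0. \<exists>v\<in>Orlicz_space \<Phi> X.
        Dirichlet_seminorm \<Phi> G S X \<alpha> (\<lambda>x. u x - v x) < \<epsilon>}"

definition Phi_Laplacian ::
  "(real \<Rightarrow> real) \<Rightarrow> ('g, 'm) monoid_scheme \<Rightarrow> 'g set \<Rightarrow> ('g \<Rightarrow> 'x \<Rightarrow> 'x)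
    \<Rightarrow> ('x \<Rightarrow> real) \<Rightarrow> 'x \<Rightarrow> real" where
  "Phi_Laplacian \<Phi> G S \<alpha> f x = (\<Sum>s\<in>S. deriv \<Phi> (f (\<alpha> (inv\<^bsub>G\<^esub> s) x) - f x))"

definition Phi_harmonic ::
  "(real \<Rightarrow> real) \<Rightarrow> ('g, 'm) monoid_scheme \<Rightarrow> 'g set \<Rightarrow> 'x set \<Rightarrow> ('g \<Rightarrow> 'x \<Rightarrow> 'x)
    \<Rightarrow> ('x \<Rightarrow> real) set" where
  "Phi_harmonic \<Phi> G S X \<alpha> =
     {f \<in> Dirichlet_space \<Phi> G X \<alpha>. \<forall>x\<in>X. Phi_Laplacian \<Phi> G S \<alpha> f x = 0}"

text \<open>
  Generating sets are symmetric, as is usual for Cayley and Schreier graphs. The Laplacian above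
  is the Euler--Lagrange operator of the Dirichlet functional only in this case, and the uniqueness
  of the decomposition fails without it: glue two copies of \<open>\<int>\<close> at \<open>0\<close>, let the free
  group on \<open>a\<close>, \<open>b\<close> act so that \<open>a\<inverse>\<close> (resp. \<open>b\<inverse>\<close>) shifts the first (resp. second) copy by
  \<open>+1\<close> and fixes the remaining points. The function equal to \<open>1\<close> at positive points of the first
  copy, \<open>0\<close> at positive points of the second and \<open>1/2\<close> elsewhere satisfies the equation with
  \<open>S = {a, b}\<close>, and lies in the closure of the Orlicz space, but is not constant on the
  single orbit.
\<close>

definition symmetric_generating_set :: "('g, 'm) monoid_scheme \<Rightarrow> 'g set \<Rightarrow> bool" where
  "symmetric_generating_set G S \<longleftrightarrow>
     S \<subseteq> carrier G \<and> generate G S = carrier G \<and> (\<forall>s\<in>S. inv\<^bsub>G\<^esub> s \<in> S)"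

end

theory Submission
  imports Defs
begin

text \<open>
  Write \<open>\<nabla>f(x,s) = f(s\<inverse>x) - f(x)\<close> for the gradient of \<open>f\<close>, a function on the edge set
  \<open>X \<times> S\<close>, and \<open>\<rho>(w) = \<Sum>\<Phi>(w(e))\<close> for the modular of a function \<open>w\<close> of edges. By \<open>\<Delta>\<^sub>2\<close> the
  Orlicz space consists of the functions of finite modular, and \<open>f\<close> is Dirichlet finite iff
  \<open>\<rho>(\<nabla>f) < \<infinity>\<close>.

  Existence is the direct method: minimize \<open>\<rho>(\<nabla>(f - v))\<close> over \<open>v\<close> in the Orlicz space. Midpoints of
  the members of a minimizing sequence \<open>v\<^sub>n\<close> cannot do better than the infimum, so strict convexity
  makes \<open>\<nabla>v\<^sub>n\<close> converge at every edge (\<open>minimizing_sequence_Cauchy\<close>). The limit is again a gradient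
  \<open>\<nabla>u\<close>, because along every orbit \<open>u\<close> can be recovered by adding up increments
  (\<open>grad_limit_integrable\<close>). Two things remain to be shown.

  First, \<open>h = f - u\<close> is \<open>\<Phi>\<close>-harmonic (\<open>harmonicI_of_minimizing_sequence\<close>). Adding a multiple of the
  indicator of a point changes only finitely many edge terms, so near-minimality of the \<open>v\<^sub>n\<close> passes
  to the pointwise limit as a statement on a finite sum, whose derivative must vanish. By summation
  by parts (\<open>summation_by_parts\<close>) this derivative is \<open>-2 \<Delta>\<^sub>\<Phi>h\<close> at the point; here the symmetry of
  \<open>S\<close> enters.

  Second, \<open>u\<close> lies in the norm closure of the Orlicz space, although the convergence is only pointwise
  and the modulars are only bounded. In a reflexive space one would use weak compactness and Mazur's
  lemma; \<open>\<nabla>\<^sub>2\<close> gives instead a direct Banach--Saks argument (\<open>energy_Banach_Saks\<close>). A bounded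
  sequence that tends to \<open>0\<close> pointwise has members that are almost disjointly supported, so the
  modular of a sum of \<open>N\<close> of them, each divided by \<open>N\<close>, is close to the sum of the \<open>N\<close> modulars,
  and \<open>\<nabla>\<^sub>2\<close> makes \<open>N \<Phi>(y/N)\<close> small compared with \<open>\<Phi>(y)\<close>. Thus averages of the \<open>v\<^sub>n\<close> converge
  to \<open>u\<close> in the Dirichlet seminorm.

  Uniqueness: for harmonic \<open>h\<close> the pairing \<open>\<Sum> \<Phi>'(\<nabla>h) \<nabla>v\<close> vanishes for \<open>v\<close> in the Orlicz space, by
  summation by parts, and then for \<open>v\<close> in its closure, because the pairing is continuous in the
  seminorm (\<open>harmonic_pairing_closure_eq_0\<close>). If \<open>u\<^sub>1 + h\<^sub>1 = u\<^sub>2 + h\<^sub>2\<close>, this gives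
  \<open>\<Sum> (\<Phi>'(\<nabla>h\<^sub>1) - \<Phi>'(\<nabla>h\<^sub>2)) (\<nabla>h\<^sub>1 - \<nabla>h\<^sub>2) = 0\<close>. All terms are nonnegative and \<open>\<Phi>'\<close> is strictly
  increasing, hence \<open>\<nabla>h\<^sub>1 = \<nabla>h\<^sub>2\<close>, and a function with zero gradient is constant on orbits.
\<close>

section \<open>Pointwise inequalities for the N-function\<close>

locale young_function =
  fixes \<Phi> :: "real \<Rightarrow> real"
  assumes even: "\<Phi> (- x) = \<Phi> x"
    and zero [simp]: "\<Phi> 0 = 0"
    and strict: "strictly_convex \<Phi>"
    and deriv: "(\<Phi> has_real_derivative deriv \<Phi> x) (at x)"
    and Delta2: "Delta2_zero \<Phi>"
    and Nabla2: "Nabla2_zero \<Phi>"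
begin

lemma convex: "convex_on UNIV \<Phi>"
proof (rule convex_onI)
  fix t x y :: real
  assume "0 < t" "t < 1"
  then show "\<Phi> ((1 - t) *\<^sub>R x + t *\<^sub>R y) \<le> (1 - t) * \<Phi> x + t * \<Phi> y"
    using strict unfolding strictly_convex_def
    by (cases "x = y") (simp_all add: less_imp_le flip: distrib_right)
qed auto

lemma convexD: "0 \<le> t \<Longrightarrow> t \<le> 1 \<Longrightarrow> \<Phi> ((1 - t) * x + t * y) \<le> (1 - t) * \<Phi> x + t * \<Phi> y"
  using convex_onD[OF convex, of t x y] by simp

lemma midpoint_strict: "x \<noteq> y \<Longrightarrow> \<Phi> ((x + y) / 2) < (\<Phi> x + \<Phi> y) / 2"
  using strict unfolding strictly_convex_def
  by (drule_tac spec[of _ x], drule_tac spec[of _ y], drule_tac spec[of _ "1/2"])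
    (auto simp: field_simps)

lemma midpoint: "\<Phi> ((x + y) / 2) \<le> (\<Phi> x + \<Phi> y) / 2"
  using midpoint_strict[of x y] by (cases "x = y") auto

lemma positive: "x \<noteq> 0 \<Longrightarrow> \<Phi> x > 0"
  using midpoint_strict[of x "- x"] by (simp add: even)

lemma nonneg [simp]: "\<Phi> x \<ge> 0"
  using positive[of x] by (cases "x = 0") auto

lemma scale_le: "0 \<le> t \<Longrightarrow> t \<le> 1 \<Longrightarrow> \<Phi> (t * x) \<le> t * \<Phi> x"
  using convexD[of t 0 x] by simp

lemma abs_arg [simp]: "\<Phi> \<bar>x\<bar> = \<Phi> x"
  using even by (cases "x \<ge> 0") (auto simp: abs_if)

lemma mono_abs: assumes "\<bar>x\<bar> \<le> \<bar>y\<bar>" shows "\<Phi> x \<le> \<Phi> y"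
proof (cases "y = 0")
  case False
  have "\<Phi> (\<bar>x\<bar> / \<bar>y\<bar> * \<bar>y\<bar>) \<le> \<bar>x\<bar> / \<bar>y\<bar> * \<Phi> \<bar>y\<bar>"
    using assms False by (intro scale_le) auto
  also have "\<dots> \<le> 1 * \<Phi> y"
    using assms False by (intro mult_mono) auto
  finally show ?thesis using False by simp
qed (use assms in auto)

text \<open>
  Sums are estimated by doubling the arguments, not through conjugate functions; the doubling
  is harmless by \<open>\<Delta>\<^sub>2\<close>.
\<close>
lemma add_le: "\<Phi> (a + b) \<le> (\<Phi> (2 * a) + \<Phi> (2 * b)) / 2"
  using midpoint[of "2 * a" "2 * b"] by (simp add: add_divide_distrib)

lemma bounded_arg:
  obtains M where "M > 0" "\<And>x. \<Phi> x \<le> R \<Longrightarrow> \<bar>x\<bar> \<le> M"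
proof -
  define M where "M = max 1 (R / \<Phi> 1)"
  have M: "M \<ge> 1" "R / \<Phi> 1 \<le> M" by (auto simp: M_def)
  have p: "\<Phi> 1 > 0" by (rule positive) simp
  have "\<bar>x\<bar> \<le> M" if "\<Phi> x \<le> R" for x
  proof (rule ccontr)
    assume "\<not> \<bar>x\<bar> \<le> M"
    then have x: "\<bar>x\<bar> > M" "\<bar>x\<bar> \<ge> 1" using M by auto
    have "\<Phi> (1 / \<bar>x\<bar> * \<bar>x\<bar>) \<le> 1 / \<bar>x\<bar> * \<Phi> \<bar>x\<bar>"
      using x by (intro scale_le) auto
    then have "\<bar>x\<bar> * \<Phi> 1 \<le> \<Phi> x" using x by (simp add: field_simps split: if_splits)
    moreover have "M * \<Phi> 1 < \<bar>x\<bar> * \<Phi> 1" using x p by simp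
    moreover have "R \<le> M * \<Phi> 1" using M p by (simp add: field_simps)
    ultimately show False using that by simp
  qed
  then show ?thesis using that[of M] M by auto
qed

text \<open>
  \<open>\<Delta>\<^sub>2\<close> near \<open>0\<close> is \<open>\<Delta>\<^sub>2\<close> on every bounded interval, as \<open>\<Phi>\<close> is bounded above on the interval
  and bounded below by a positive constant away from \<open>0\<close>. This suffices on a discrete set, where a
  bound on the modular bounds the values.
\<close>
lemma Delta2_bounded_double:
  obtains K where "K \<ge> 0" "\<And>x. \<bar>x\<bar> \<le> M \<Longrightarrow> \<Phi> (2 * x) \<le> K * \<Phi> x"
proof -
  obtain x0 K where K: "x0 > 0" "K > 2" "\<And>x. 0 \<le> x \<Longrightarrow> x \<le> x0 \<Longrightarrow> \<Phi> (2 * x) \<le> K * \<Phi> x"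
    using Delta2 unfolding Delta2_zero_def by blast
  have p: "\<Phi> x0 > 0" using K by (intro positive) auto
  define L where "L = max K (\<Phi> (2 * M) / \<Phi> x0)"
  have L: "L \<ge> 0" "L \<ge> K" "\<Phi> (2 * M) / \<Phi> x0 \<le> L" using K by (auto simp: L_def)
  have "\<Phi> (2 * x) \<le> L * \<Phi> x" if "\<bar>x\<bar> \<le> M" for x
  proof (cases "\<bar>x\<bar> \<le> x0")
    case True
    have "\<Phi> (2 * x) = \<Phi> (2 * \<bar>x\<bar>)"
      by (metis abs_arg abs_mult abs_numeral abs_abs)
    also have "\<dots> \<le> K * \<Phi> \<bar>x\<bar>" using K(3)[of "\<bar>x\<bar>"] True by simp
    also have "\<dots> \<le> L * \<Phi> x" using L by (simp add: mult_right_mono)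
    finally show ?thesis .
  next
    case False
    have "\<Phi> (2 * x) \<le> \<Phi> (2 * M)" using that by (intro mono_abs) auto
    also have "\<dots> \<le> L * \<Phi> x0" using L p by (simp add: field_simps)
    also have "\<dots> \<le> L * \<Phi> x" using L False K by (intro mult_left_mono mono_abs) auto
    finally show ?thesis .
  qed
  then show ?thesis using that L by blast
qed

lemma Delta2_bounded:
  obtains K where "K \<ge> 0" "\<And>x. \<bar>x\<bar> \<le> M \<Longrightarrow> \<Phi> (c * x) \<le> K * \<Phi> x"
proof -
  have pow: "\<exists>K\<ge>0. \<forall>x. \<bar>x\<bar> \<le> M \<longrightarrow> \<Phi> (2 ^ n * x) \<le> K * \<Phi> x" for n
  proof (induction n)
    case 0
    then show ?case by (intro exI[of _ 1]) auto
  next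
    case (Suc n)
    then obtain K where K: "K \<ge> 0" "\<And>x. \<bar>x\<bar> \<le> M \<Longrightarrow> \<Phi> (2 ^ n * x) \<le> K * \<Phi> x" by blast
    obtain L where L: "L \<ge> 0" "\<And>x. \<bar>x\<bar> \<le> 2 ^ n * M \<Longrightarrow> \<Phi> (2 * x) \<le> L * \<Phi> x"
      using Delta2_bounded_double by blast
    have "\<Phi> (2 ^ Suc n * x) \<le> L * K * \<Phi> x" if "\<bar>x\<bar> \<le> M" for x
    proof -
      have "\<Phi> (2 * (2 ^ n * x)) \<le> L * \<Phi> (2 ^ n * x)"
        using that by (intro L) (simp add: abs_mult)
      also have "\<dots> \<le> L * (K * \<Phi> x)" using L K that by (intro mult_left_mono) auto
      finally show ?thesis by (simp add: mult.assoc)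
    qed
    then show ?case using L K by (intro exI[of _ "L * K"]) auto
  qed
  obtain n where n: "\<bar>c\<bar> < 2 ^ n" using real_arch_pow[of 2 "\<bar>c\<bar>"] by auto
  obtain K where K: "K \<ge> 0" "\<And>x. \<bar>x\<bar> \<le> M \<Longrightarrow> \<Phi> (2 ^ n * x) \<le> K * \<Phi> x" using pow by blast
  have "\<Phi> (c * x) \<le> K * \<Phi> x" if "\<bar>x\<bar> \<le> M" for x
  proof -
    have "\<Phi> (c * x) \<le> \<Phi> (2 ^ n * x)"
      using n by (intro mono_abs) (auto simp: abs_mult intro!: mult_right_mono)
    then show ?thesis using K that by fastforce
  qed
  then show ?thesis using that K by blast
qed

lemma slope_mono:
  assumes "0 < x" "x \<le> y" shows "\<Phi> x / x \<le> \<Phi> y / y"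
  using scale_le[of "x / y" y] assms by (simp add: field_simps)

text \<open>
  The slope \<open>q(y) = \<Phi>(y)/y\<close> is nondecreasing, and \<open>\<nabla>\<^sub>2\<close> says \<open>q(x) \<le> q(cx)/2\<close> for small \<open>x\<close>. By
  iteration \<open>q(y/c\<^sup>k) \<le> 2\<^sup>-\<^sup>k q(y)\<close> for small \<open>y\<close>, and the claim is \<open>q(y/N) \<le> \<epsilon> q(y)\<close>. A larger \<open>y\<close>
  is compared with \<open>x0\<close>, by the monotonicity of \<open>q\<close>: it is enough that \<open>y/N\<close> falls below
  \<open>x0/c\<^sup>k\<close>.
\<close>
lemma Nabla2_bounded:
  assumes "\<epsilon> > 0" "M > 0"
  obtains N :: nat where "N \<ge> 2" "\<And>y. \<bar>y\<bar> \<le> M \<Longrightarrow> N * \<Phi> (y / N) \<le> \<epsilon> * \<Phi> y"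
proof -
  obtain x0 c where c: "x0 > 0" "c > 1"
    "\<And>x. 0 \<le> x \<Longrightarrow> x \<le> x0 \<Longrightarrow> \<Phi> x \<le> 1 / (2 * c) * \<Phi> (c * x)"
    using Nabla2 unfolding Nabla2_zero_def by blast
  have iter: "\<Phi> (y / c ^ k) / (y / c ^ k) \<le> (1/2) ^ k * (\<Phi> y / y)" if y: "0 < y" "y \<le> x0" for y k
  proof (induction k)
    case (Suc k)
    define x where "x = y / c ^ Suc k"
    have ck: "1 \<le> c ^ Suc k" using c by (intro one_le_power) auto
    have x: "x > 0" using y c by (simp add: x_def)
    have "y * 1 \<le> x0 * c ^ Suc k" using y ck c by (intro mult_mono) auto
    then have "x \<le> x0" using ck c by (simp add: x_def field_simps)
    then have "\<Phi> x \<le> 1 / (2 * c) * \<Phi> (c * x)" using x c by auto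
    then have "\<Phi> x / x \<le> 1 / (2 * c) * \<Phi> (c * x) / x"
      using x by (intro divide_right_mono) auto
    also have "\<dots> = (1/2) * (\<Phi> (c * x) / (c * x))" using c x by (simp add: field_simps)
    also have "c * x = y / c ^ k" using c by (simp add: x_def)
    finally show ?case using Suc unfolding x_def by simp
  qed simp
  obtain k where k: "(1/2) ^ k < \<epsilon>" using real_arch_pow_inv[of \<epsilon> "1/2"] assms by auto
  define A where "A = max 2 (max (c ^ k) (M * c ^ k / x0))"
  obtain N :: nat where "A < N" using reals_Archimedean2 by blast
  then have N: "2 < real N" "c ^ k < N" "M * c ^ k / x0 < N" by (auto simp: A_def)
  have cp: "c ^ k > 0" using c by simp
  have "N * \<Phi> (y / N) \<le> \<epsilon> * \<Phi> y" if "\<bar>y\<bar> \<le> M" for y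
  proof (cases "y = 0")
    case False
    define z where "z = min \<bar>y\<bar> x0"
    have z: "0 < z" "z \<le> x0" "z \<le> \<bar>y\<bar>" using False c by (auto simp: z_def)
    have "\<bar>y\<bar> / N \<le> z / c ^ k"
    proof (cases "\<bar>y\<bar> \<le> x0")
      case True
      then show ?thesis using N cp by (auto simp: z_def intro!: divide_left_mono)
    next
      case False
      have "\<bar>y\<bar> * c ^ k \<le> M * c ^ k" using that cp by simp
      also have "\<dots> \<le> x0 * N" using N c by (simp add: field_simps)
      finally show ?thesis using False N cp by (simp add: z_def field_simps)
    qed
    then have "\<Phi> (\<bar>y\<bar> / N) / (\<bar>y\<bar> / N) \<le> \<Phi> (z / c ^ k) / (z / c ^ k)"
      using False N by (intro slope_mono) auto
    also have "\<dots> \<le> (1/2) ^ k * (\<Phi> z / z)" using iter z by blast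
    also have "\<dots> \<le> \<epsilon> * (\<Phi> \<bar>y\<bar> / \<bar>y\<bar>)"
      using k z assms by (intro mult_mono slope_mono) auto
    finally have "N * \<Phi> (\<bar>y\<bar> / N) \<le> \<epsilon> * \<Phi> \<bar>y\<bar>"
      using False N by (simp add: field_simps)
    moreover have "\<Phi> (\<bar>y\<bar> / N) = \<Phi> (y / N)"
      by (metis abs_arg abs_divide abs_of_nat)
    ultimately show ?thesis by simp
  qed simp
  then show ?thesis using that[of N] N by auto
qed

lemma tangent: "\<Phi> x \<ge> \<Phi> c + deriv \<Phi> c * (x - c)"
  using convex_on_imp_above_tangent[OF convex, of c x "deriv \<Phi> c"] deriv by simp

text \<open>
  Add the tangent inequalities at \<open>a\<close> and at \<open>b\<close>, both evaluated at the midpoint.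
\<close>
lemma deriv_strict_mono:
  assumes "a \<noteq> b" shows "(deriv \<Phi> a - deriv \<Phi> b) * (a - b) > 0"
proof -
  have "\<Phi> a + deriv \<Phi> a * ((a + b) / 2 - a) \<le> \<Phi> ((a + b) / 2)"
    "\<Phi> b + deriv \<Phi> b * ((a + b) / 2 - b) \<le> \<Phi> ((a + b) / 2)"
    by (rule tangent)+
  with midpoint_strict[OF assms] show ?thesis by (simp add: field_simps)
qed

lemma deriv_odd: "deriv \<Phi> (- x) = - deriv \<Phi> x"
proof -
  have "((\<lambda>y. \<Phi> (- y)) has_real_derivative deriv \<Phi> x * (-1)) (at (- x))"
    using deriv by (intro DERIV_chain2) (auto intro!: derivative_eq_intros)
  then have "(\<Phi> has_real_derivative - deriv \<Phi> x) (at (- x))"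
    by (simp add: even)
  then show ?thesis using deriv DERIV_unique by blast
qed

text \<open>
  A substitute for Young's inequality that avoids the conjugate function: by the tangent inequality
  \<open>\<Phi>'(a) b \<le> \<Phi>(a + b) - \<Phi>(a)\<close>.
\<close>
lemma deriv_mult_le: "\<bar>deriv \<Phi> a * b\<bar> \<le> \<Phi> (2 * a) + \<Phi> (2 * b)"
proof -
  have *: "deriv \<Phi> a * d \<le> \<Phi> (2 * a) + \<Phi> (2 * d)" for d
  proof -
    have "deriv \<Phi> a * d \<le> \<Phi> (a + d)" using tangent[of a "a + d"] nonneg[of a] by (simp del: nonneg)
    also have "\<dots> \<le> (\<Phi> (2 * a) + \<Phi> (2 * d)) / 2" by (rule add_le)
    also have "\<dots> \<le> \<Phi> (2 * a) + \<Phi> (2 * d)"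
      using add_nonneg_nonneg[OF nonneg nonneg] by (simp add: field_simps)
    finally show ?thesis .
  qed
  have "- (deriv \<Phi> a * b) \<le> \<Phi> (2 * a) + \<Phi> (2 * b)"
    using *[of "- b"] even[of "2 * b"] by simp
  then show ?thesis using *[of b] by linarith
qed

lemma continuous: "continuous_on A \<Phi>"
  using deriv by (meson DERIV_isCont continuous_at_imp_continuous_on)

lemma tendsto: "(g \<longlongrightarrow> l) F \<Longrightarrow> ((\<lambda>n. \<Phi> (g n)) \<longlongrightarrow> \<Phi> l) F"
  using isCont_tendsto_compose DERIV_isCont deriv by blast

text \<open>
  Strict convexity is uniform on bounded sets: the midpoint gap is continuous and positive on the
  compact set of pairs at distance at least \<open>\<epsilon>\<close>.
\<close>
lemma uniform_gap:
  assumes "\<epsilon> > 0"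
  obtains \<delta> where "\<delta> > 0"
    "\<And>a b. \<bar>a\<bar> \<le> M \<Longrightarrow> \<bar>b\<bar> \<le> M \<Longrightarrow> \<bar>a - b\<bar> \<ge> \<epsilon> \<Longrightarrow> (\<Phi> a + \<Phi> b) / 2 - \<Phi> ((a + b) / 2) \<ge> \<delta>"
proof -
  define T where "T = {p \<in> {-M..M} \<times> {-M..M}. \<bar>fst p - snd p\<bar> \<ge> \<epsilon>}"
  define q where "q p = (\<Phi> (fst p) + \<Phi> (snd p)) / 2 - \<Phi> ((fst p + snd p) / 2)" for p
  have "T = ({-M..M} \<times> {-M..M}) \<inter> {p. \<epsilon> \<le> \<bar>fst p - snd p\<bar>}" by (auto simp: T_def)
  also have "compact \<dots>"
    by (intro compact_Int_closed compact_Times compact_Icc closed_Collect_le continuous_intros)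
  finally have T: "compact T" .
  have q: "continuous_on T q"
    unfolding q_def
    by (intro continuous_intros continuous_on_compose2[OF continuous[of UNIV]]) auto
  have pos: "q p > 0" if "p \<in> T" for p
    using midpoint_strict[of "fst p" "snd p"] that assms by (auto simp: q_def T_def)
  show ?thesis
  proof (cases "T = {}")
    case True
    have "(\<Phi> a + \<Phi> b) / 2 - \<Phi> ((a + b) / 2) \<ge> 1"
      if "\<bar>a\<bar> \<le> M" "\<bar>b\<bar> \<le> M" "\<bar>a - b\<bar> \<ge> \<epsilon>" for a b
    proof -
      have "(a, b) \<in> T" using that by (auto simp: T_def)
      then show ?thesis using True by simp
    qed
    then show ?thesis using that[of 1] by auto
  next
    case False
    obtain p where p: "p \<in> T" "\<And>p'. p' \<in> T \<Longrightarrow> q p \<le> q p'"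
      using continuous_attains_inf[OF T False q] by blast
    have "(\<Phi> a + \<Phi> b) / 2 - \<Phi> ((a + b) / 2) \<ge> q p"
      if "\<bar>a\<bar> \<le> M" "\<bar>b\<bar> \<le> M" "\<bar>a - b\<bar> \<ge> \<epsilon>" for a b
    proof -
      have "(a, b) \<in> T" using that by (auto simp: T_def)
      from p(2)[OF this] show ?thesis by (simp add: q_def)
    qed
    then show ?thesis using that[of "q p"] p(1) pos by auto
  qed
qed

section \<open>The modular on an index set\<close>

definition finite_energy :: "'i set \<Rightarrow> ('i \<Rightarrow> real) \<Rightarrow> bool" where
  "finite_energy I w \<longleftrightarrow> (\<lambda>i. \<Phi> (w i)) summable_on I"

definition energy :: "'i set \<Rightarrow> ('i \<Rightarrow> real) \<Rightarrow> real" where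
  "energy I w = (\<Sum>\<^sub>\<infinity>i\<in>I. \<Phi> (w i))"

lemma energy_leI:
  assumes "\<And>F. finite F \<Longrightarrow> F \<subseteq> I \<Longrightarrow> (\<Sum>i\<in>F. \<Phi> (w i)) \<le> R"
  shows "finite_energy I w" "energy I w \<le> R"
proof -
  show *: "finite_energy I w"
    unfolding finite_energy_def
    by (rule nonneg_bdd_above_summable_on) (auto intro!: bdd_aboveI[of _ R] assms)
  show "energy I w \<le> R"
    unfolding energy_def
    by (rule infsum_le_finite_sums) (use * assms in \<open>auto simp: finite_energy_def\<close>)
qed

lemma sum_le_energy:
  "finite_energy I w \<Longrightarrow> finite F \<Longrightarrow> F \<subseteq> I \<Longrightarrow> (\<Sum>i\<in>F. \<Phi> (w i)) \<le> energy I w"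
  unfolding finite_energy_def energy_def by (rule finite_sum_le_infsum) auto

lemma le_energy: "finite_energy I w \<Longrightarrow> i \<in> I \<Longrightarrow> \<Phi> (w i) \<le> energy I w"
  using sum_le_energy[of I w "{i}"] by simp

lemma energy_nonneg: "energy I w \<ge> 0"
  unfolding energy_def by (rule infsum_nonneg) simp

lemma finite_energy_mono:
  assumes "finite_energy I w" "\<And>i. i \<in> I \<Longrightarrow> \<bar>w' i\<bar> \<le> \<bar>w i\<bar>"
  shows "finite_energy I w'" "energy I w' \<le> energy I w"
proof -
  have "(\<Sum>i\<in>F. \<Phi> (w' i)) \<le> energy I w" if "finite F" "F \<subseteq> I" for F
  proof -
    have "(\<Sum>i\<in>F. \<Phi> (w' i)) \<le> (\<Sum>i\<in>F. \<Phi> (w i))"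
      using assms that by (intro sum_mono mono_abs) auto
    then show ?thesis using sum_le_energy[OF assms(1) that] by linarith
  qed
  from energy_leI[where I = I, OF this] show "finite_energy I w'" "energy I w' \<le> energy I w"
    by auto
qed

lemma finite_energy_cong:
  "(\<And>i. i \<in> I \<Longrightarrow> w i = w' i) \<Longrightarrow> finite_energy I w \<longleftrightarrow> finite_energy I w'"
  unfolding finite_energy_def by (intro summable_on_cong) auto

lemma energy_cong: "(\<And>i. i \<in> I \<Longrightarrow> w i = w' i) \<Longrightarrow> energy I w = energy I w'"
  unfolding energy_def by (intro infsum_cong) auto

text \<open>
  A bound on the modular bounds the values, so \<open>\<Delta>\<^sub>2\<close> applies with one constant to all \<open>w\<close> of bounded
  modular. In particular finiteness of the modular is stable under scaling.
\<close>
lemma energy_scale_bounded: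
  obtains R' where "R' \<ge> 0"
    "\<And>w. finite_energy I w \<Longrightarrow> energy I w \<le> R \<Longrightarrow>
      finite_energy I (\<lambda>i. c * w i) \<and> energy I (\<lambda>i. c * w i) \<le> R'"
proof -
  obtain M where M: "\<And>x. \<Phi> x \<le> R \<Longrightarrow> \<bar>x\<bar> \<le> M" using bounded_arg by blast
  obtain K where K: "K \<ge> 0" "\<And>x. \<bar>x\<bar> \<le> M \<Longrightarrow> \<Phi> (c * x) \<le> K * \<Phi> x" using Delta2_bounded by blast
  have "finite_energy I (\<lambda>i. c * w i) \<and> energy I (\<lambda>i. c * w i) \<le> K * max R 0"
    if w: "finite_energy I w" "energy I w \<le> R" for w
  proof -
    have "(\<Sum>i\<in>F. \<Phi> (c * w i)) \<le> K * max R 0" if F: "finite F" "F \<subseteq> I" for F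
    proof -
      have "(\<Sum>i\<in>F. \<Phi> (c * w i)) \<le> (\<Sum>i\<in>F. K * \<Phi> (w i))"
      proof (rule sum_mono)
        fix i assume "i \<in> F"
        then have "\<Phi> (w i) \<le> R" using le_energy[OF w(1), of i] w(2) F by auto
        then show "\<Phi> (c * w i) \<le> K * \<Phi> (w i)" using M K by blast
      qed
      also have "\<dots> = K * (\<Sum>i\<in>F. \<Phi> (w i))" by (simp add: sum_distrib_left)
      also have "\<dots> \<le> K * max R 0"
        using sum_le_energy[OF w(1) F] w(2) K by (intro mult_left_mono) auto
      finally show ?thesis .
    qed
    then show ?thesis using energy_leI[of I "\<lambda>i. c * w i"] by blast
  qed
  then show ?thesis using that[of "K * max R 0"] K by auto
qed

lemma finite_energy_scale: "finite_energy I w \<Longrightarrow> finite_energy I (\<lambda>i. c * w i)"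
  by (metis energy_scale_bounded order_refl)

lemma energy_add_le:
  assumes "finite_energy I v" "finite_energy I w"
  shows "finite_energy I (\<lambda>i. v i + w i)"
    "energy I (\<lambda>i. v i + w i) \<le> (energy I (\<lambda>i. 2 * v i) + energy I (\<lambda>i. 2 * w i)) / 2"
proof -
  have "(\<Sum>i\<in>F. \<Phi> (v i + w i)) \<le> (energy I (\<lambda>i. 2 * v i) + energy I (\<lambda>i. 2 * w i)) / 2"
    if F: "finite F" "F \<subseteq> I" for F
  proof -
    have "(\<Sum>i\<in>F. \<Phi> (v i + w i)) \<le> (\<Sum>i\<in>F. (\<Phi> (2 * v i) + \<Phi> (2 * w i)) / 2)"
      by (intro sum_mono add_le)
    also have "\<dots> = ((\<Sum>i\<in>F. \<Phi> (2 * v i)) + (\<Sum>i\<in>F. \<Phi> (2 * w i))) / 2"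
      by (simp add: sum.distrib sum_divide_distrib[symmetric])
    also have "\<dots> \<le> (energy I (\<lambda>i. 2 * v i) + energy I (\<lambda>i. 2 * w i)) / 2"
      by (intro divide_right_mono add_mono sum_le_energy finite_energy_scale assms F) simp
    finally show ?thesis .
  qed
  from energy_leI[where I = I, OF this] show "finite_energy I (\<lambda>i. v i + w i)"
    "energy I (\<lambda>i. v i + w i) \<le> (energy I (\<lambda>i. 2 * v i) + energy I (\<lambda>i. 2 * w i)) / 2"
    by auto
qed

lemmas finite_energy_add = energy_add_le(1)

lemma finite_energy_minus: "finite_energy I w \<Longrightarrow> finite_energy I (\<lambda>i. - w i)"
  using finite_energy_scale[of I w "-1"] by simp

lemma finite_energy_diff:
  "finite_energy I v \<Longrightarrow> finite_energy I w \<Longrightarrow> finite_energy I (\<lambda>i. v i - w i)"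
  using finite_energy_add[of I v "\<lambda>i. - w i"] finite_energy_minus[of I w] by simp

lemma finite_energy_0: "finite_energy I (\<lambda>i. 0)"
  by (simp add: finite_energy_def)

lemma finite_energy_sum:
  "(\<And>l. l \<in> A \<Longrightarrow> finite_energy I (w l)) \<Longrightarrow> finite_energy I (\<lambda>i. \<Sum>l\<in>A. w l i)"
  by (induction A rule: infinite_finite_induct) (auto intro: finite_energy_add simp: finite_energy_0)

lemma energy_Fatou:
  assumes "\<And>n. finite_energy I (w n)" "\<And>n. energy I (w n) \<le> R"
    and lim: "\<And>i. i \<in> I \<Longrightarrow> (\<lambda>n. w n i) \<longlonglongrightarrow> v i"
  shows "finite_energy I v" "energy I v \<le> R"
proof -
  have "(\<Sum>i\<in>F. \<Phi> (v i)) \<le> R" if F: "finite F" "F \<subseteq> I" for F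
  proof (rule LIMSEQ_le_const2)
    show "(\<lambda>n. \<Sum>i\<in>F. \<Phi> (w n i)) \<longlonglongrightarrow> (\<Sum>i\<in>F. \<Phi> (v i))"
      using F lim by (intro tendsto_sum tendsto) auto
    show "\<exists>N. \<forall>n\<ge>N. (\<Sum>i\<in>F. \<Phi> (w n i)) \<le> R"
      using sum_le_energy[OF assms(1) F] assms(2) order_trans by blast
  qed
  from energy_leI[where I = I, OF this] show "finite_energy I v" "energy I v \<le> R" by auto
qed

lemma energy_split:
  assumes w: "finite_energy I w" and F: "finite F" "F \<subseteq> I"
  shows "energy I w = (\<Sum>i\<in>F. \<Phi> (w i)) + energy (I - F) w"
proof -
  have "infsum (\<lambda>i. \<Phi> (w i)) (F \<union> (I - F)) =
      infsum (\<lambda>i. \<Phi> (w i)) F + infsum (\<lambda>i. \<Phi> (w i)) (I - F)"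
    using w F unfolding finite_energy_def
    by (intro infsum_Un_disjoint) (auto intro: summable_on_subset_banach)
  moreover have "F \<union> (I - F) = I" using F by auto
  ultimately show ?thesis using F by (simp add: energy_def)
qed

text \<open>
  Outside a finite set \<open>F\<close> the modular of \<open>a\<close> is negligible, and on \<open>F\<close> the \<open>c\<^sub>n\<close> tend to \<open>0\<close>
  uniformly, so \<open>a\<close> and \<open>c\<^sub>n\<close> have almost disjoint supports. The constant \<open>1\<close> before both modulars
  on the right is essential, since the lemma is iterated over many summands; \<open>add_le\<close> would lose a
  factor in each step.
\<close>
lemma energy_almost_additive:
  assumes a: "finite_energy I a"
    and c: "\<And>n. finite_energy I (c n)"
    and R: "\<And>n. energy I (\<lambda>i. 2 * c n i) \<le> R"
    and lim: "\<And>i. i \<in> I \<Longrightarrow> (\<lambda>n. c n i) \<longlonglongrightarrow> 0"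
    and \<eta>: "\<eta> > 0"
  shows "\<forall>\<^sub>F n in sequentially. energy I (\<lambda>i. a i + c n i) \<le> energy I a + energy I (c n) + \<eta>"
proof -
  have R0: "R \<ge> 0" using R energy_nonneg order_trans by blast
  define \<delta> where "\<delta> = \<eta> / (R + \<eta> + 1)"
  have "0 < R + \<eta> + 1" using R0 \<eta> by simp
  then have \<delta>: "0 < \<delta>" "\<delta> < 1" "\<delta> * (R + \<eta>) \<le> \<eta>"
    using R0 \<eta> by (auto simp: \<delta>_def field_simps)
  define b where "b = (\<lambda>i. 2 / \<delta> * a i)"
  have b: "finite_energy I b" unfolding b_def by (rule finite_energy_scale[OF a])
  obtain F where F: "finite F" "F \<subseteq> I" "dist (\<Sum>i\<in>F. \<Phi> (b i)) (energy I b) \<le> \<eta>"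
    using infsum_finite_approximation[of "\<lambda>i. \<Phi> (b i)" I \<eta>] b \<eta>
    unfolding finite_energy_def energy_def by auto
  have sm: "(\<lambda>i. \<Phi> (w i)) summable_on I - F" if "finite_energy I w" for w
    using that unfolding finite_energy_def by (auto intro: summable_on_subset_banach)
  note split = energy_split[OF _ F(1,2)]
  have tail_b: "energy (I - F) b \<le> \<eta>" using F(3) split[OF b] by (simp add: dist_real_def)
  \<comment> \<open>Writing \<open>x + y\<close> as a convex combination of \<open>y\<close> and \<open>x / \<delta> + y\<close> keeps the coefficient of
    \<open>\<Phi> y\<close> at most 1; the price is the large factor \<open>2 / \<delta>\<close> on \<open>x\<close>, paid by choosing \<open>F\<close>
    for \<open>2 / \<delta> * a\<close> in place of \<open>a\<close>.\<close>
  have point: "\<Phi> (x + y) \<le> \<Phi> y + \<delta> / 2 * \<Phi> (2 * y) + \<delta> / 2 * \<Phi> (2 / \<delta> * x)" for x y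
  proof -
    have "x + y = (1 - \<delta>) * y + \<delta> * (x / \<delta> + y)" using \<delta> by (simp add: field_simps)
    then have "\<Phi> (x + y) \<le> (1 - \<delta>) * \<Phi> y + \<delta> * \<Phi> (x / \<delta> + y)"
      using convexD[of \<delta> y "x / \<delta> + y"] \<delta> by simp
    also have "\<dots> \<le> 1 * \<Phi> y + \<delta> * ((\<Phi> (2 * (x / \<delta>)) + \<Phi> (2 * y)) / 2)"
      using \<delta> by (intro add_mono mult_right_mono mult_left_mono add_le) auto
    finally show ?thesis by (simp add: field_simps)
  qed
  have tail: "energy (I - F) (\<lambda>i. a i + c n i) \<le> energy (I - F) (c n) + \<eta> / 2" for n
  proof -
    have s: "(\<lambda>i. \<Phi> (c n i)) summable_on I - F" "(\<lambda>i. \<Phi> (2 * c n i)) summable_on I - F"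
      "(\<lambda>i. \<Phi> (b i)) summable_on I - F" "(\<lambda>i. \<Phi> (a i + c n i)) summable_on I - F"
      by (intro sm finite_energy_scale finite_energy_add a b c)+
    have "energy (I - F) (\<lambda>i. a i + c n i) \<le>
      (\<Sum>\<^sub>\<infinity>i\<in>I - F. \<Phi> (c n i) + \<delta> / 2 * \<Phi> (2 * c n i) + \<delta> / 2 * \<Phi> (b i))"
      unfolding energy_def using point
      by (intro infsum_mono s summable_on_add summable_on_cmult_right) (auto simp: b_def)
    also have "\<dots> = energy (I - F) (c n) + \<delta> / 2 * energy (I - F) (\<lambda>i. 2 * c n i)
        + \<delta> / 2 * energy (I - F) b"
      unfolding energy_def
      by (intro infsumI has_sum_add has_sum_cmult_right has_sum_infsum s)
    also have "\<dots> \<le> energy (I - F) (c n) + \<delta> / 2 * R + \<delta> / 2 * \<eta>"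
    proof -
      have "energy (I - F) (\<lambda>i. 2 * c n i) \<le> R"
        using split[OF finite_energy_scale[OF c[of n], of 2]] R[of n]
          sum_nonneg[of F "\<lambda>i. \<Phi> (2 * c n i)"] by simp
      then show ?thesis using \<delta> tail_b by (intro add_mono mult_left_mono) auto
    qed
    finally show ?thesis using \<delta>(3) by (simp add: algebra_simps)
  qed
  have "(\<lambda>n. \<Sum>i\<in>F. \<Phi> (a i + c n i)) \<longlonglongrightarrow> (\<Sum>i\<in>F. \<Phi> (a i + 0))"
    using F lim by (intro tendsto_sum tendsto tendsto_add tendsto_const) auto
  then have "\<forall>\<^sub>F n in sequentially. (\<Sum>i\<in>F. \<Phi> (a i + c n i)) < (\<Sum>i\<in>F. \<Phi> (a i)) + \<eta> / 2"
    using \<eta> by (intro order_tendstoD(2)) auto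
  then show ?thesis
  proof eventually_elim
    case (elim n)
    have "energy I (\<lambda>i. a i + c n i) =
        (\<Sum>i\<in>F. \<Phi> (a i + c n i)) + energy (I - F) (\<lambda>i. a i + c n i)"
      by (intro split finite_energy_add a c)
    moreover have "(\<Sum>i\<in>F. \<Phi> (a i)) \<le> energy I a" using sum_le_energy[OF a] F by blast
    moreover have "energy (I - F) (c n) \<le> energy I (c n)"
      using split[OF c[of n]] sum_nonneg[of F "\<lambda>i. \<Phi> (c n i)"] by simp
    ultimately show ?case using tail[of n] elim by simp
  qed
qed

text \<open>
  The indices \<open>k l\<close> are chosen one after the other, each so late that the new term is almost disjoint
  from the sum of the earlier ones. The modular of the average is then at most the sum of the \<open>N\<close>
  modulars of the \<open>b n / N\<close>, plus an error, and \<open>\<nabla>\<^sub>2\<close> bounds each of them by a small multiple of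
  \<open>R / N\<close>.
\<close>
lemma energy_Banach_Saks:
  assumes b: "\<And>n. finite_energy I (b n)"
    and R: "\<And>n. energy I (b n) \<le> R"
    and lim: "\<And>i. i \<in> I \<Longrightarrow> (\<lambda>n. b n i) \<longlonglongrightarrow> 0"
    and \<epsilon>: "\<epsilon> > 0"
  obtains N :: nat and k :: "nat \<Rightarrow> nat"
    where "N > 0" "energy I (\<lambda>i. (\<Sum>l<N. b (k l) i) / N) \<le> \<epsilon>"
proof -
  have R0: "R \<ge> 0" using R energy_nonneg order_trans by blast
  obtain M where M: "M > 0" "\<And>x. \<Phi> x \<le> R \<Longrightarrow> \<bar>x\<bar> \<le> M" using bounded_arg by blast
  define \<epsilon>' where "\<epsilon>' = \<epsilon> / (2 * (R + 1))"
  have \<epsilon>': "\<epsilon>' > 0" "\<epsilon>' * R \<le> \<epsilon> / 2" using \<epsilon> R0 by (auto simp: \<epsilon>'_def field_simps)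
  obtain N :: nat where N: "N \<ge> 2" "\<And>y. \<bar>y\<bar> \<le> M \<Longrightarrow> N * \<Phi> (y / N) \<le> \<epsilon>' * \<Phi> y"
    using Nabla2_bounded[OF \<epsilon>'(1) M(1)] by blast
  define c where "c n i = b n i / N" for n i
  have c: "finite_energy I (c n)" for n
    unfolding c_def using finite_energy_scale[OF b, of "1 / N"] by simp
  have c_energy: "energy I (c n) \<le> \<epsilon>' * R / N" for n
  proof (rule energy_leI)
    fix F assume F: "finite F" "F \<subseteq> I"
    have "(\<Sum>i\<in>F. \<Phi> (c n i)) \<le> (\<Sum>i\<in>F. \<epsilon>' / N * \<Phi> (b n i))"
    proof (rule sum_mono)
      fix i assume "i \<in> F"
      then have "\<Phi> (b n i) \<le> R" using le_energy[OF b, of i n] R[of n] F by auto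
      then show "\<Phi> (c n i) \<le> \<epsilon>' / N * \<Phi> (b n i)"
        using N(2)[OF M(2)] N(1) by (simp add: c_def field_simps)
    qed
    also have "\<dots> = \<epsilon>' / N * (\<Sum>i\<in>F. \<Phi> (b n i))" by (simp add: sum_distrib_left)
    also have "\<dots> \<le> \<epsilon>' / N * R"
      using sum_le_energy[OF b F, of n] R[of n] \<epsilon>' by (intro mult_left_mono) auto
    finally show "(\<Sum>i\<in>F. \<Phi> (c n i)) \<le> \<epsilon>' * R / N" by simp
  qed
  \<comment> \<open>Here \<open>N \<ge> 2\<close> is used: twice \<open>c n\<close> is still dominated by \<open>b n\<close>.\<close>
  have c2: "energy I (\<lambda>i. 2 * c n i) \<le> R" for n
  proof -
    have "energy I (\<lambda>i. 2 * c n i) \<le> energy I (b n)"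
    proof (rule finite_energy_mono(2)[OF b])
      fix i
      have "\<bar>b n i\<bar> * 2 \<le> \<bar>b n i\<bar> * N" using N by (intro mult_left_mono) auto
      then show "\<bar>2 * c n i\<bar> \<le> \<bar>b n i\<bar>"
        using N by (simp add: c_def abs_mult field_simps)
    qed
    then show ?thesis using R[of n] by simp
  qed
  have clim: "(\<lambda>n. c n i) \<longlonglongrightarrow> 0" if "i \<in> I" for i
    unfolding c_def using tendsto_divide_zero[OF lim[OF that]] by simp
  define T where "T = \<epsilon>' * R / N + \<epsilon> / (2 * N)"
  have sums: "\<exists>k::nat \<Rightarrow> nat. energy I (\<lambda>i. \<Sum>l<j. c (k l) i) \<le> j * T"
    for j :: nat
  proof (induction j)
    case 0
    then show ?case by (simp add: energy_def)
  next
    case (Suc j)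
    then obtain k :: "nat \<Rightarrow> nat" where
      k: "energy I (\<lambda>i. \<Sum>l<j. c (k l) i) \<le> j * T" by blast
    have "\<forall>\<^sub>F n in sequentially. energy I (\<lambda>i. (\<Sum>l<j. c (k l) i) + c n i)
        \<le> energy I (\<lambda>i. \<Sum>l<j. c (k l) i) + energy I (c n) + \<epsilon> / (2 * N)"
      using \<epsilon> N by (intro energy_almost_additive[OF _ c c2 clim] finite_energy_sum c) auto
    then obtain n where n: "energy I (\<lambda>i. (\<Sum>l<j. c (k l) i) + c n i)
        \<le> energy I (\<lambda>i. \<Sum>l<j. c (k l) i) + energy I (c n) + \<epsilon> / (2 * N)"
      by (auto simp: eventually_sequentially)
    have "(\<lambda>i. \<Sum>l<Suc j. c ((k(j := n)) l) i) = (\<lambda>i. (\<Sum>l<j. c (k l) i) + c n i)"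
      by (auto simp: fun_eq_iff intro!: sum.cong)
    moreover have "energy I (c n) + \<epsilon> / (2 * N) \<le> T" using c_energy[of n] by (simp add: T_def)
    moreover have "real (Suc j) * T = j * T + T" by (simp add: algebra_simps)
    ultimately show ?case using n k by (intro exI[of _ "k(j := n)"]) simp
  qed
  obtain k :: "nat \<Rightarrow> nat" where
    k: "energy I (\<lambda>i. \<Sum>l<N. c (k l) i) \<le> N * T" using sums by blast
  have "N * T = \<epsilon>' * R + \<epsilon> / 2" using N by (simp add: T_def field_simps)
  also have "\<dots> \<le> \<epsilon>" using \<epsilon>' by simp
  finally show ?thesis using k N that[of N k] by (simp add: c_def sum_divide_distrib)
qed

text \<open>
  The midpoint gaps of two late members sum to at most \<open>(\<rho>(w\<^sub>n) + \<rho>(w\<^sub>k))/2 - m\<close>, which is small.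
  Each gap is nonnegative, so the gap at \<open>i\<close> is small, and by \<open>uniform_gap\<close> so is
  \<open>w\<^sub>n(i) - w\<^sub>k(i)\<close>.
\<close>
lemma minimizing_sequence_Cauchy:
  assumes w: "\<And>n. finite_energy I (w n)"
    and lim: "(\<lambda>n. energy I (w n)) \<longlonglongrightarrow> m"
    and mid: "\<And>n k. energy I (\<lambda>i. (w n i + w k i) / 2) \<ge> m"
    and i: "i \<in> I"
  shows "Cauchy (\<lambda>n. w n i)"
proof (rule metric_CauchyI)
  fix \<epsilon> :: real assume \<epsilon>: "\<epsilon> > 0"
  obtain R where R: "\<And>n. energy I (w n) \<le> R"
    using convergent_imp_Bseq[OF convergentI[OF lim]] by (metis BseqE abs_le_D1 real_norm_def)
  obtain M where M: "\<And>x. \<Phi> x \<le> R \<Longrightarrow> \<bar>x\<bar> \<le> M" using bounded_arg by blast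
  obtain \<delta> where \<delta>: "\<delta> > 0"
    "\<And>a b. \<bar>a\<bar> \<le> M \<Longrightarrow> \<bar>b\<bar> \<le> M \<Longrightarrow> \<bar>a - b\<bar> \<ge> \<epsilon> \<Longrightarrow> (\<Phi> a + \<Phi> b) / 2 - \<Phi> ((a + b) / 2) \<ge> \<delta>"
    using uniform_gap[OF \<epsilon>] by blast
  have "\<forall>\<^sub>F n in sequentially. energy I (w n) < m + \<delta>"
    using lim \<delta> by (intro order_tendstoD(2)) auto
  then obtain N where N: "\<And>n. n \<ge> N \<Longrightarrow> energy I (w n) < m + \<delta>"
    by (auto simp: eventually_sequentially)
  have "\<bar>w n i - w k i\<bar> < \<epsilon>" if nk: "n \<ge> N" "k \<ge> N" for n k
  proof (rule ccontr)
    assume "\<not> \<bar>w n i - w k i\<bar> < \<epsilon>"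
    moreover have "\<bar>w n i\<bar> \<le> M" for n using le_energy[OF w i, of n] R[of n] M by auto
    ultimately have gap: "(\<Phi> (w n i) + \<Phi> (w k i)) / 2 - \<Phi> ((w n i + w k i) / 2) \<ge> \<delta>"
      using \<delta>(2) by auto
    have half: "finite_energy I (\<lambda>j. (w n j + w k j) / 2)"
      using finite_energy_scale[OF finite_energy_add[OF w w, of n k], of "1/2"] by simp
    have s: "(\<lambda>j. \<Phi> (w n j)) summable_on I" "(\<lambda>j. \<Phi> (w k j)) summable_on I"
      "(\<lambda>j. \<Phi> ((w n j + w k j) / 2)) summable_on I"
      using w half unfolding finite_energy_def by auto
    define g where "g j = 1/2 * \<Phi> (w n j) + 1/2 * \<Phi> (w k j) + (-1) * \<Phi> ((w n j + w k j) / 2)" for j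
    have g: "g summable_on I"
      unfolding g_def by (intro summable_on_add summable_on_cmult_right s)
    have "infsum g I = 1/2 * energy I (w n) + 1/2 * energy I (w k)
        + (-1) * energy I (\<lambda>j. (w n j + w k j) / 2)"
      unfolding g_def energy_def
      by (intro infsumI has_sum_add has_sum_cmult_right has_sum_infsum s)
    moreover have "sum g {i} \<le> infsum g I"
      using i midpoint by (intro finite_sum_le_infsum g) (auto simp: g_def field_simps)
    ultimately show False
      using gap mid[of n k] N[OF nk(1)] N[OF nk(2)] by (simp add: g_def add_divide_distrib)
  qed
  then show "\<exists>N. \<forall>n\<ge>N. \<forall>k\<ge>N. dist (w n i) (w k i) < \<epsilon>" by (auto simp: dist_real_def)
qed

lemma pairing_summable:
  assumes "finite_energy I a" "finite_energy I b"
  shows "(\<lambda>i. deriv \<Phi> (a i) * b i) summable_on I"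
proof -
  have "(\<lambda>i. \<Phi> (2 * a i) + \<Phi> (2 * b i)) summable_on I"
    using finite_energy_scale[OF assms(1), of 2] finite_energy_scale[OF assms(2), of 2]
    unfolding finite_energy_def by (rule summable_on_add)
  then have "(\<lambda>i. norm (deriv \<Phi> (a i) * b i)) summable_on I"
    by (rule Infinite_Sum.abs_summable_on_comparison_test') (use deriv_mult_le in auto)
  then show ?thesis using summable_on_iff_abs_summable_on_real by blast
qed

section \<open>The Orlicz space and the gauge norm\<close>

text \<open>
  The real-valued \<open>energy\<close> of a divergent sum is a default value, so a bound for the
  \<open>[0, \<infinity>]\<close>-valued modular corresponds to a bound for \<open>energy\<close> together with \<open>finite_energy\<close>.
\<close>
lemma modular_le_iff:
  assumes "r \<ge> 0"
  shows "modular \<Phi> X f \<le> ennreal r \<longleftrightarrow> finite_energy X f \<and> energy X f \<le> r"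
proof -
  have "modular \<Phi> X f = (SUP F\<in>{F. finite F \<and> F \<subseteq> X}. \<Sum>x\<in>F. ennreal (\<Phi> (f x)))"
    unfolding modular_def by (rule nonneg_infsum_complete) simp
  also have "\<dots> = (SUP F\<in>{F. finite F \<and> F \<subseteq> X}. ennreal (\<Sum>x\<in>F. \<Phi> (f x)))"
    by simp
  finally have "modular \<Phi> X f \<le> ennreal r \<longleftrightarrow>
      (\<forall>F. finite F \<and> F \<subseteq> X \<longrightarrow> (\<Sum>x\<in>F. \<Phi> (f x)) \<le> r)"
    using assms by (auto simp: SUP_le_iff ennreal_le_iff)
  also have "\<dots> \<longleftrightarrow> finite_energy X f \<and> energy X f \<le> r"
    using energy_leI[of X f r] sum_le_energy[of X f] order_trans by blast
  finally show ?thesis .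
qed

lemma Orlicz_space_iff: "f \<in> Orlicz_space \<Phi> X \<longleftrightarrow> finite_energy X f"
proof
  assume "f \<in> Orlicz_space \<Phi> X"
  then obtain a where a: "a > 0" "modular \<Phi> X (\<lambda>x. a * f x) < \<infinity>"
    unfolding Orlicz_space_def by blast
  then obtain r where "r \<ge> 0" "modular \<Phi> X (\<lambda>x. a * f x) = ennreal r"
    by (cases "modular \<Phi> X (\<lambda>x. a * f x)") auto
  then have "finite_energy X (\<lambda>x. a * f x)" using modular_le_iff[of r X "\<lambda>x. a * f x"] by simp
  from finite_energy_scale[OF this, of "1 / a"] show "finite_energy X f" using a by simp
next
  assume "finite_energy X f"
  then have "modular \<Phi> X f \<le> ennreal (energy X f)"
    using modular_le_iff energy_nonneg by blast
  then show "f \<in> Orlicz_space \<Phi> X"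
    unfolding Orlicz_space_def
    by (auto intro!: exI[of _ 1] simp: le_less_trans)
qed

lemma gauge_norm_le:
  assumes "k > 0" "finite_energy X (\<lambda>x. f x / k)" "energy X (\<lambda>x. f x / k) \<le> 1"
  shows "gauge_norm \<Phi> X f \<le> k"
  unfolding gauge_norm_def
proof (rule cInf_lower)
  show "k \<in> {k. k > 0 \<and> modular \<Phi> X (\<lambda>x. f x / k) \<le> 1}"
    using assms modular_le_iff[of 1 X "\<lambda>x. f x / k"] by simp
qed (auto intro!: bdd_belowI[of _ 0])

text \<open>
  The infimum defining the gauge norm is a default value if it is taken over the empty set; for functions of
  finite modular, \<open>\<Phi>(tx) \<le> t \<Phi>(x)\<close> for \<open>t \<le> 1\<close> provides a member.
\<close>
lemma gauge_set_nonempty: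
  assumes "finite_energy X f"
  shows "{k. k > 0 \<and> modular \<Phi> X (\<lambda>x. f x / k) \<le> 1} \<noteq> {}"
proof -
  define k where "k = max 1 (energy X f)"
  have k: "k \<ge> 1" "energy X f \<le> k" by (auto simp: k_def)
  have "(\<Sum>x\<in>F. \<Phi> (f x / k)) \<le> 1" if F: "finite F" "F \<subseteq> X" for F
  proof -
    have "(\<Sum>x\<in>F. \<Phi> (f x / k)) \<le> (\<Sum>x\<in>F. 1 / k * \<Phi> (f x))"
      using scale_le[of "1 / k"] k by (intro sum_mono) auto
    also have "\<dots> = 1 / k * (\<Sum>x\<in>F. \<Phi> (f x))" by (simp add: sum_distrib_left)
    also have "\<dots> \<le> 1" using sum_le_energy[OF assms F] k by simp
    finally show ?thesis .
  qed
  then have "modular \<Phi> X (\<lambda>x. f x / k) \<le> ennreal 1"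
    using modular_le_iff[of 1 X "\<lambda>x. f x / k"] energy_leI[of X "\<lambda>x. f x / k" 1] by simp
  then have "k \<in> {k. k > 0 \<and> modular \<Phi> X (\<lambda>x. f x / k) \<le> 1}" using k by simp
  then show ?thesis by blast
qed

lemma gauge_norm_nonneg: "finite_energy X f \<Longrightarrow> gauge_norm \<Phi> X f \<ge> 0"
  unfolding gauge_norm_def by (rule cInf_greatest) (auto dest: gauge_set_nonempty)

lemma energy_le_of_gauge_norm:
  assumes f: "finite_energy X f" and less: "gauge_norm \<Phi> X f < k"
  shows "finite_energy X (\<lambda>x. f x / k)" "energy X (\<lambda>x. f x / k) \<le> 1"
proof -
  obtain l where l: "0 < l" "l < k" "modular \<Phi> X (\<lambda>x. f x / l) \<le> 1"
    using cInf_lessD[OF gauge_set_nonempty[OF f]] less unfolding gauge_norm_def by blast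
  then have "finite_energy X (\<lambda>x. f x / l)" "energy X (\<lambda>x. f x / l) \<le> 1"
    using modular_le_iff[of 1 X "\<lambda>x. f x / l"] by auto
  moreover have "\<bar>f x / k\<bar> \<le> \<bar>f x / l\<bar>" for x
    using l by (auto simp: abs_divide intro!: divide_left_mono)
  ultimately show "finite_energy X (\<lambda>x. f x / k)" "energy X (\<lambda>x. f x / k) \<le> 1"
    using finite_energy_mono[of X "\<lambda>x. f x / l" "\<lambda>x. f x / k"] by auto
qed

end

section \<open>Gradients for a group action\<close>

lemma has_sum_finite_sum:
  fixes F :: "'s \<Rightarrow> 'x \<Rightarrow> real"
  assumes "\<And>s. s \<in> S \<Longrightarrow> (F s has_sum a s) X"
  shows "((\<lambda>x. \<Sum>s\<in>S. F s x) has_sum (\<Sum>s\<in>S. a s)) X"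
  using assms by (induction S rule: infinite_finite_induct) (auto intro: has_sum_add)

lemma has_sum_Times_finite:
  fixes F :: "'x \<times> 's \<Rightarrow> real"
  assumes "finite S" "\<And>s. s \<in> S \<Longrightarrow> ((\<lambda>x. F (x, s)) has_sum a s) X"
  shows "(F has_sum (\<Sum>s\<in>S. a s)) (X \<times> S)"
  using assms
proof (induction S rule: finite_induct)
  case (insert s S)
  have "bij_betw (\<lambda>x. (x, s)) X (X \<times> {s})" by (auto simp: bij_betw_def inj_on_def)
  from has_sum_reindex_bij_betw[OF this, of F] have "(F has_sum a s) (X \<times> {s})"
    using insert.prems[of s] by simp
  then have "(F has_sum (a s + sum a S)) (X \<times> {s} \<union> X \<times> S)"
    using insert by (intro has_sum_Un_disjoint) auto
  moreover have "X \<times> {s} \<union> X \<times> S = X \<times> insert s S" by auto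
  ultimately show ?case using insert by simp
qed simp

locale orlicz_action = young_function \<Phi> + group_action G X \<alpha>
  for \<Phi> :: "real \<Rightarrow> real"
    and G :: "('g, 'm) monoid_scheme" (structure)
    and X :: "'x set"
    and \<alpha> :: "'g \<Rightarrow> 'x \<Rightarrow> 'x" +
  fixes S :: "'g set"
  assumes finite_S: "finite S"
    and symmetric: "symmetric_generating_set G S"
begin

sublocale grp: group G
  using group_hom group_hom.axioms(1) by blast

abbreviation edges :: "('x \<times> 'g) set" where "edges \<equiv> X \<times> S"

definition grad :: "('x \<Rightarrow> real) \<Rightarrow> 'x \<times> 'g \<Rightarrow> real" where
  "grad f = (\<lambda>(x, s). f (\<alpha> (inv s) x) - f x)"

lemma S_carrier: "s \<in> S \<Longrightarrow> s \<in> carrier G"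
  using symmetric unfolding symmetric_generating_set_def by blast

lemma S_inv: "s \<in> S \<Longrightarrow> inv s \<in> S"
  using symmetric unfolding symmetric_generating_set_def by blast

text \<open>
  The set \<open>S\<close> is closed under inverses, so every element is a product of generators and the case of
  inverses in the inductive definition of \<open>generate\<close> reduces to that of generators.
\<close>
lemma generating_induct [consumes 1, case_names one gen mult]:
  assumes g: "g \<in> carrier G"
    and one: "P \<one>" and gen: "\<And>s. s \<in> S \<Longrightarrow> P s"
    and mult: "\<And>g h. g \<in> carrier G \<Longrightarrow> h \<in> carrier G \<Longrightarrow> P g \<Longrightarrow> P h \<Longrightarrow> P (g \<otimes> h)"
  shows "P g"
proof -
  have gS: "generate G S = carrier G"
    using symmetric unfolding symmetric_generating_set_def by blast
  have "g \<in> generate G S" using g gS by simp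
  then show ?thesis
    by (induction rule: generate.induct) (use assms gS S_inv in auto)
qed

lemma act_closed: "g \<in> carrier G \<Longrightarrow> x \<in> X \<Longrightarrow> \<alpha> g x \<in> X"
  using element_image by blast

lemma act_one: "x \<in> X \<Longrightarrow> \<alpha> \<one> x = x"
  using id_eq_one by (metis restrict_apply')

lemma act_inv_mult:
  "g \<in> carrier G \<Longrightarrow> h \<in> carrier G \<Longrightarrow> x \<in> X \<Longrightarrow> \<alpha> (inv (g \<otimes> h)) x = \<alpha> (inv h) (\<alpha> (inv g) x)"
  by (simp add: grp.inv_mult_group composition_rule)

lemma act_inv_act: "g \<in> carrier G \<Longrightarrow> x \<in> X \<Longrightarrow> \<alpha> (inv g) (\<alpha> g x) = x"
  using orbit_sym_aux by blast

lemma act_act_inv: "g \<in> carrier G \<Longrightarrow> x \<in> X \<Longrightarrow> \<alpha> g (\<alpha> (inv g) x) = x"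
  using act_inv_act[of "inv g" x] by simp

lemma act_bij: "g \<in> carrier G \<Longrightarrow> bij_betw (\<alpha> g) X X"
  using bij_prop0 by (auto simp: Bij_def)

lemma energy_edges:
  assumes "\<And>s. s \<in> S \<Longrightarrow> finite_energy X (\<lambda>x. w (x, s))"
  shows "finite_energy edges w" "energy edges w = (\<Sum>s\<in>S. energy X (\<lambda>x. w (x, s)))"
proof -
  have "((\<lambda>e. \<Phi> (w e)) has_sum (\<Sum>s\<in>S. energy X (\<lambda>x. w (x, s)))) edges"
    using assms unfolding finite_energy_def energy_def
    by (intro has_sum_Times_finite finite_S) auto
  then show "finite_energy edges w" "energy edges w = (\<Sum>s\<in>S. energy X (\<lambda>x. w (x, s)))"
    unfolding finite_energy_def energy_def by (auto simp: has_sum_iff)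
qed

lemma energy_slice_le:
  assumes "finite_energy edges w" "s \<in> S"
  shows "finite_energy X (\<lambda>x. w (x, s))" "energy X (\<lambda>x. w (x, s)) \<le> energy edges w"
proof -
  have "(\<Sum>x\<in>F. \<Phi> (w (x, s))) \<le> energy edges w" if F: "finite F" "F \<subseteq> X" for F
  proof -
    have "(\<Sum>x\<in>F. \<Phi> (w (x, s))) = (\<Sum>e\<in>F \<times> {s}. \<Phi> (w e))"
      by (simp add: sum.cartesian_product')
    also have "\<dots> \<le> energy edges w" using F assms by (intro sum_le_energy) auto
    finally show ?thesis .
  qed
  from energy_leI[where I = X, OF this]
  show "finite_energy X (\<lambda>x. w (x, s))" "energy X (\<lambda>x. w (x, s)) \<le> energy edges w" by auto
qed

lemma finite_energy_translate:
  assumes "g \<in> carrier G" "finite_energy X v"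
  shows "finite_energy X (\<lambda>x. v (\<alpha> g x))"
  using assms summable_on_reindex_bij_betw[OF act_bij[OF assms(1)], of "\<lambda>x. \<Phi> (v x)"]
  unfolding finite_energy_def by simp

text \<open>
  The increments by generators control all others, because
  \<open>\<lambda>(gh)f - f = \<lambda>(g)(\<lambda>(h)f - f) + (\<lambda>(g)f - f)\<close> and the modular is invariant under translations.
\<close>
lemma Dirichlet_space_iff: "f \<in> Dirichlet_space \<Phi> G X \<alpha> \<longleftrightarrow> finite_energy edges (grad f)"
proof
  assume "f \<in> Dirichlet_space \<Phi> G X \<alpha>"
  then show "finite_energy edges (grad f)"
    unfolding Dirichlet_space_def translate_def Orlicz_space_iff
    by (intro energy_edges) (auto simp: grad_def S_carrier)
next
  assume fin: "finite_energy edges (grad f)"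
  have "finite_energy X (\<lambda>x. f (\<alpha> (inv g) x) - f x)" if "g \<in> carrier G" for g
    using that
  proof (induction g rule: generating_induct)
    case one
    have "finite_energy X (\<lambda>x. f (\<alpha> (inv \<one>) x) - f x) \<longleftrightarrow> finite_energy X (\<lambda>x. 0)"
      by (intro finite_energy_cong) (simp add: act_one)
    then show ?case using finite_energy_0 by simp
  next
    case (gen s)
    then show ?case using energy_slice_le(1)[OF fin, of s] by (simp add: grad_def)
  next
    case (mult g h)
    have "finite_energy X (\<lambda>x. (f (\<alpha> (inv h) (\<alpha> (inv g) x)) - f (\<alpha> (inv g) x)) +
        (f (\<alpha> (inv g) x) - f x))"
      using finite_energy_translate[OF _ mult(4), of "inv g"] mult by (intro finite_energy_add) auto
    moreover have "finite_energy X (\<lambda>x. f (\<alpha> (inv (g \<otimes> h)) x) - f x) \<longleftrightarrow>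
        finite_energy X (\<lambda>x. (f (\<alpha> (inv h) (\<alpha> (inv g) x)) - f (\<alpha> (inv g) x)) +
        (f (\<alpha> (inv g) x) - f x))"
      by (intro finite_energy_cong) (simp add: act_inv_mult mult)
    ultimately show ?case by simp
  qed
  then show "f \<in> Dirichlet_space \<Phi> G X \<alpha>"
    unfolding Dirichlet_space_def translate_def Orlicz_space_iff by blast
qed

lemma grad_diff: "grad (\<lambda>x. f x - g x) e = grad f e - grad g e"
  by (simp add: grad_def case_prod_unfold)

lemma finite_energy_grad:
  assumes "finite_energy X v" shows "finite_energy edges (grad v)"
  unfolding grad_def
  by (intro energy_edges)
    (auto intro!: finite_energy_diff finite_energy_translate assms simp: S_carrier)

lemma grad_eq_0_imp_invariant:
  assumes grad: "\<And>e. e \<in> edges \<Longrightarrow> grad f e = 0" and g: "g \<in> carrier G"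
  shows "\<forall>x\<in>X. f (\<alpha> (inv g) x) = f x"
  using g
proof (induction g rule: generating_induct)
  case one
  then show ?case by (simp add: act_one)
next
  case (gen s)
  then show ?case using grad[of "(_, s)"] by (simp add: grad_def)
next
  case (mult g h)
  then show ?case by (simp add: act_inv_mult act_closed)
qed

lemma grad_eq_0_imp_Dirichlet_invariants:
  assumes grad: "\<And>e. e \<in> edges \<Longrightarrow> grad f e = 0"
  shows "f \<in> Dirichlet_invariants \<Phi> G X \<alpha>"
proof -
  have "finite_energy edges (grad f) \<longleftrightarrow> finite_energy edges (\<lambda>e. 0)"
    by (intro finite_energy_cong grad)
  then have "f \<in> Dirichlet_space \<Phi> G X \<alpha>"
    unfolding Dirichlet_space_iff by (simp add: finite_energy_0)
  moreover have "f constant_on Y" if Y: "Y \<in> orbits G X \<alpha>" for Y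
  proof -
    obtain x where x: "x \<in> X" "Y = {\<alpha> g x | g. g \<in> carrier G}"
      using Y unfolding orbits_def orbit_def by blast
    have "f (\<alpha> g x) = f x" if "g \<in> carrier G" for g
      using grad_eq_0_imp_invariant[OF grad, of "inv g"] that x(1) by simp
    then show ?thesis using x(2) unfolding constant_on_def by auto
  qed
  ultimately show ?thesis unfolding Dirichlet_invariants_def by blast
qed

text \<open>
  Fix \<open>s\<close> and put \<open>B(s) = \<Sum> \<Phi>'(h(s\<inverse>x) - h(x)) v(x)\<close>. Substituting \<open>x = sy\<close> in
  \<open>\<Sum> \<Phi>'(h(s\<inverse>x) - h(x)) v(s\<inverse>x)\<close> turns it into \<open>\<Sum> \<Phi>'(h(y) - h(sy)) v(y) = -B(s\<inverse>)\<close>, as \<open>\<Phi>'\<close> is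
  odd. Hence the left-hand side is \<open>\<Sum> (-B(s\<inverse>) - B(s))\<close>, and since \<open>S\<close> is symmetric both parts
  contribute the same amount.
\<close>
lemma summation_by_parts:
  assumes h: "h \<in> Dirichlet_space \<Phi> G X \<alpha>" and v: "v \<in> Orlicz_space \<Phi> X"
  shows "(\<Sum>\<^sub>\<infinity>e\<in>edges. deriv \<Phi> (grad h e) * grad v e) =
    -2 * (\<Sum>\<^sub>\<infinity>x\<in>X. Phi_Laplacian \<Phi> G S \<alpha> h x * v x)"
proof -
  define P where "P s x = deriv \<Phi> (h (\<alpha> (inv s) x) - h x)" for s x
  define B where "B s = (\<Sum>\<^sub>\<infinity>x\<in>X. P s x * v x)" for s
  have slice: "finite_energy X (\<lambda>x. h (\<alpha> (inv s) x) - h x)" if "s \<in> S" for s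
    using energy_slice_le(1)[of "grad h" s] h that by (simp add: Dirichlet_space_iff grad_def)
  have v': "finite_energy X v" using v by (simp add: Orlicz_space_iff)
  have B: "((\<lambda>x. P s x * v x) has_sum B s) X" if "s \<in> S" for s
    unfolding B_def P_def
    by (intro has_sum_infsum pairing_summable slice v' that)
  have A: "((\<lambda>x. P s x * v (\<alpha> (inv s) x)) has_sum - B (inv s)) X" if s: "s \<in> S" for s
  proof -
    have sc: "s \<in> carrier G" using s S_carrier by blast
    have "((\<lambda>x. - (P (inv s) x * v x)) has_sum - B (inv s)) X"
      using B[OF S_inv[OF s]] by (simp add: has_sum_uminus)
    then have "((\<lambda>x. - (P (inv s) (\<alpha> (inv s) x) * v (\<alpha> (inv s) x))) has_sum - B (inv s)) X"
      using has_sum_reindex_bij_betw[OF act_bij[of "inv s"],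
          of "\<lambda>x. - (P (inv s) x * v x)" "- B (inv s)"] sc by simp
    moreover have "- (P (inv s) (\<alpha> (inv s) x) * v (\<alpha> (inv s) x)) = P s x * v (\<alpha> (inv s) x)"
      if "x \<in> X" for x
      using deriv_odd[of "h (\<alpha> (inv s) x) - h x"] act_act_inv[OF sc that] sc
      by (simp add: P_def)
    ultimately show ?thesis by (simp cong: has_sum_cong)
  qed
  have "((\<lambda>e. deriv \<Phi> (grad h e) * grad v e) has_sum (\<Sum>s\<in>S. - B (inv s) + (- 1) * B s)) edges"
  proof (rule has_sum_Times_finite[OF finite_S])
    fix s assume s: "s \<in> S"
    have "((\<lambda>x. P s x * v (\<alpha> (inv s) x) + (- 1) * (P s x * v x)) has_sum
        (- B (inv s) + (- 1) * B s)) X"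
      by (intro has_sum_add has_sum_cmult_right A B s)
    then show "((\<lambda>x. deriv \<Phi> (grad h (x, s)) * grad v (x, s)) has_sum
        (- B (inv s) + (- 1) * B s)) X"
      by (simp add: P_def grad_def algebra_simps)
  qed
  moreover have "(\<Sum>s\<in>S. B (inv s)) = (\<Sum>s\<in>S. B s)"
    by (rule sum.reindex_bij_witness[of _ "\<lambda>s. inv s" "\<lambda>s. inv s"]) (auto simp: S_inv S_carrier)
  moreover have "((\<lambda>x. \<Sum>s\<in>S. P s x * v x) has_sum (\<Sum>s\<in>S. B s)) X"
    by (intro has_sum_finite_sum B)
  then have "(\<Sum>\<^sub>\<infinity>x\<in>X. Phi_Laplacian \<Phi> G S \<alpha> h x * v x) = (\<Sum>s\<in>S. B s)"
    by (auto intro!: infsumI simp: Phi_Laplacian_def P_def sum_distrib_right)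
  ultimately show ?thesis
    by (simp add: has_sum_iff sum.distrib sum_negf sum_subtractf)
qed

section \<open>Uniqueness\<close>

text \<open>
  Choose \<open>v\<close> in the Orlicz space such that \<open>z = \<nabla>(u - v)\<close> has gauge norm below \<open>\<epsilon>\<close> on the slice
  \<open>X \<times> {s}\<close> of each generator; then the modular of \<open>z / \<epsilon>\<close> is at most \<open>1\<close> there. By
  \<open>deriv_mult_le\<close>, applied to \<open>z / (2\<epsilon>)\<close>, the pairing of \<open>\<Phi>'(\<nabla>h)\<close> with \<open>z\<close> is at most \<open>\<epsilon>\<close> times
  a constant independent of \<open>v\<close>, and the pairing with \<open>\<nabla>v\<close> is zero.
\<close>
lemma harmonic_pairing_closure_eq_0:
  assumes h: "h \<in> Phi_harmonic \<Phi> G S X \<alpha>" and u: "u \<in> Orlicz_closure \<Phi> G S X \<alpha>"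
  shows "(\<Sum>\<^sub>\<infinity>e\<in>edges. deriv \<Phi> (grad h e) * grad u e) = 0"
proof -
  have hD: "h \<in> Dirichlet_space \<Phi> G X \<alpha>" using h unfolding Phi_harmonic_def by blast
  have uD: "u \<in> Dirichlet_space \<Phi> G X \<alpha>" using u unfolding Orlicz_closure_def by blast
  have gh: "finite_energy edges (grad h)" and gu: "finite_energy edges (grad u)"
    using hD uD by (auto simp: Dirichlet_space_iff)
  define p where "p = (\<Sum>\<^sub>\<infinity>e\<in>edges. deriv \<Phi> (grad h e) * grad u e)"
  define C where "C = 2 * (energy edges (\<lambda>e. 2 * grad h e) + card S)"
  have C: "C \<ge> 0" using energy_nonneg[of edges "\<lambda>e. 2 * grad h e"] by (simp add: C_def)
  have bound: "\<bar>p\<bar> \<le> \<epsilon> * C" if \<epsilon>: "\<epsilon> > 0" for \<epsilon>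
  proof -
    obtain v where v: "v \<in> Orlicz_space \<Phi> X"
      and less: "Dirichlet_seminorm \<Phi> G S X \<alpha> (\<lambda>x. u x - v x) < \<epsilon>"
      using u \<epsilon> unfolding Orlicz_closure_def by blast
    define z where "z = grad (\<lambda>x. u x - v x)"
    have gv: "finite_energy edges (grad v)"
      using v finite_energy_grad by (simp add: Orlicz_space_iff)
    have z_eq: "z = (\<lambda>e. grad u e - grad v e)" by (auto simp: z_def grad_diff)
    have z: "finite_energy edges z" unfolding z_eq by (intro finite_energy_diff gu gv)
    have zs: "finite_energy X (\<lambda>x. z (x, s))" if "s \<in> S" for s
      using energy_slice_le(1)[OF z that] .
    have "gauge_norm \<Phi> X (\<lambda>x. z (x, s)) < \<epsilon>" if s: "s \<in> S" for s
    proof -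
      have "gauge_norm \<Phi> X (\<lambda>x. z (x, s)) \<le> (\<Sum>s\<in>S. gauge_norm \<Phi> X (\<lambda>x. z (x, s)))"
        using gauge_norm_nonneg[OF zs] s finite_S by (intro member_le_sum) auto
      also have "\<dots> < \<epsilon>"
        using less by (simp add: Dirichlet_seminorm_def translate_def z_def grad_def)
      finally show ?thesis .
    qed
    note y = energy_le_of_gauge_norm[OF zs this]
    have fy: "finite_energy edges (\<lambda>e. z e / \<epsilon>)" and ey: "energy edges (\<lambda>e. z e / \<epsilon>) \<le> card S"
      using energy_edges[of "\<lambda>e. z e / \<epsilon>"] y sum_bounded_above[of S _ "1::real"] by auto
    have fz: "(\<lambda>e. deriv \<Phi> (grad h e) * z e) summable_on edges"
      by (intro pairing_summable gh z)
    have fv: "(\<lambda>e. deriv \<Phi> (grad h e) * grad v e) summable_on edges"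
      by (intro pairing_summable gh gv)
    have "(\<Sum>\<^sub>\<infinity>x\<in>X. Phi_Laplacian \<Phi> G S \<alpha> h x * v x) = (\<Sum>\<^sub>\<infinity>x\<in>X. 0)"
      using h unfolding Phi_harmonic_def by (intro infsum_cong) auto
    then have "(\<Sum>\<^sub>\<infinity>e\<in>edges. deriv \<Phi> (grad h e) * grad v e) = 0"
      using summation_by_parts[OF hD v] by simp
    then have "p = (\<Sum>\<^sub>\<infinity>e\<in>edges. deriv \<Phi> (grad h e) * z e)"
      using infsum_add[OF fz fv] by (simp add: p_def z_eq algebra_simps)
    moreover have "\<bar>\<Sum>\<^sub>\<infinity>e\<in>edges. deriv \<Phi> (grad h e) * z e\<bar> \<le>
        (\<Sum>\<^sub>\<infinity>e\<in>edges. 2 * \<epsilon> * (\<Phi> (2 * grad h e) + \<Phi> (z e / \<epsilon>)))"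
    proof -
      have s1: "(\<lambda>e. 2 * \<epsilon> * (\<Phi> (2 * grad h e) + \<Phi> (z e / \<epsilon>))) summable_on edges"
        using finite_energy_scale[OF gh, of 2] fy unfolding finite_energy_def
        by (intro summable_on_cmult_right summable_on_add)
      have le: "\<bar>deriv \<Phi> (grad h e) * z e\<bar> \<le> 2 * \<epsilon> * (\<Phi> (2 * grad h e) + \<Phi> (z e / \<epsilon>))" for e
      proof -
        have "\<bar>deriv \<Phi> (grad h e) * (z e / (2 * \<epsilon>))\<bar> \<le> \<Phi> (2 * grad h e) + \<Phi> (z e / \<epsilon>)"
          using deriv_mult_le[of "grad h e" "z e / (2 * \<epsilon>)"] by simp
        then have "2 * \<epsilon> * \<bar>deriv \<Phi> (grad h e) * (z e / (2 * \<epsilon>))\<bar> \<le>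
            2 * \<epsilon> * (\<Phi> (2 * grad h e) + \<Phi> (z e / \<epsilon>))"
          using \<epsilon> by (intro mult_left_mono) auto
        moreover have "2 * \<epsilon> * \<bar>deriv \<Phi> (grad h e) * (z e / (2 * \<epsilon>))\<bar> = \<bar>deriv \<Phi> (grad h e) * z e\<bar>"
          using \<epsilon> by (simp add: abs_mult)
        ultimately show ?thesis by simp
      qed
      have "norm (\<Sum>\<^sub>\<infinity>e\<in>edges. deriv \<Phi> (grad h e) * z e) \<le>
        (\<Sum>\<^sub>\<infinity>e\<in>edges. 2 * \<epsilon> * (\<Phi> (2 * grad h e) + \<Phi> (z e / \<epsilon>)))"
        by (rule norm_infsum_le[OF has_sum_infsum[OF fz] has_sum_infsum[OF s1]]) (use le in auto)
      then show ?thesis by simp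
    qed
    moreover have "(\<Sum>\<^sub>\<infinity>e\<in>edges. 2 * \<epsilon> * (\<Phi> (2 * grad h e) + \<Phi> (z e / \<epsilon>))) =
        2 * \<epsilon> * (energy edges (\<lambda>e. 2 * grad h e) + energy edges (\<lambda>e. z e / \<epsilon>))"
      using finite_energy_scale[OF gh, of 2] fy unfolding finite_energy_def energy_def
      by (intro infsumI has_sum_cmult_right has_sum_add has_sum_infsum)
    moreover have "\<dots> \<le> \<epsilon> * C" using ey \<epsilon> by (simp add: C_def mult_left_mono)
    ultimately show ?thesis by simp
  qed
  have "\<bar>p\<bar> \<le> 0"
  proof (rule field_le_epsilon)
    fix \<epsilon> :: real assume "\<epsilon> > 0"
    then have "\<bar>p\<bar> \<le> \<epsilon> / (C + 1) * C" using C by (intro bound) simp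
    also have "\<dots> \<le> \<epsilon>" using C \<open>\<epsilon> > 0\<close> by (simp add: field_simps)
    finally show "\<bar>p\<bar> \<le> 0 + \<epsilon>" by simp
  qed
  then show ?thesis by (simp add: p_def)
qed

lemma decomposition_grad_unique:
  assumes u: "u1 \<in> Orlicz_closure \<Phi> G S X \<alpha>" "u2 \<in> Orlicz_closure \<Phi> G S X \<alpha>"
    and h: "h1 \<in> Phi_harmonic \<Phi> G S X \<alpha>" "h2 \<in> Phi_harmonic \<Phi> G S X \<alpha>"
    and eq: "\<And>x. x \<in> X \<Longrightarrow> u1 x + h1 x = u2 x + h2 x"
    and e: "e \<in> edges"
  shows "grad h1 e = grad h2 e" "grad u1 e = grad u2 e"
proof -
  have fin: "finite_energy edges (grad u1)" "finite_energy edges (grad u2)"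
    "finite_energy edges (grad h1)" "finite_energy edges (grad h2)"
    using u h unfolding Orlicz_closure_def Phi_harmonic_def by (auto simp: Dirichlet_space_iff)
  have geq: "grad h1 e - grad h2 e = grad u2 e - grad u1 e" if "e \<in> edges" for e
  proof -
    obtain x s where xs: "e = (x, s)" "x \<in> X" "s \<in> S" using \<open>e \<in> edges\<close> by auto
    then have "\<alpha> (inv s) x \<in> X" by (simp add: act_closed S_carrier)
    then show ?thesis using eq[of x] eq[of "\<alpha> (inv s) x"] xs by (simp add: grad_def)
  qed
  \<comment> \<open>The four products are kept apart, with a coefficient on two of them, so that the sum of \<open>T\<close> is
    by linearity a combination of the four pairings known to vanish.\<close>
  define T where "T e = deriv \<Phi> (grad h1 e) * grad u2 e + (-1) * (deriv \<Phi> (grad h1 e) * grad u1 e) +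
      ((-1) * (deriv \<Phi> (grad h2 e) * grad u2 e) + deriv \<Phi> (grad h2 e) * grad u1 e)" for e
  have T_eq: "T e = (deriv \<Phi> (grad h1 e) - deriv \<Phi> (grad h2 e)) * (grad h1 e - grad h2 e)"
    if "e \<in> edges" for e
    unfolding geq[OF that] T_def by (simp add: algebra_simps)
  have "(T has_sum (0 + (-1) * 0 + ((-1) * 0 + 0))) edges"
    unfolding T_def
    by (intro has_sum_add has_sum_cmult_right)
      (auto simp: has_sum_iff harmonic_pairing_closure_eq_0 u h intro!: pairing_summable fin)
  then have T: "(T has_sum 0) edges" by simp
  have T_nonneg: "T e \<ge> 0" if "e \<in> edges" for e
    using deriv_strict_mono[of "grad h1 e" "grad h2 e"] T_eq[OF that]
    by (cases "grad h1 e = grad h2 e") auto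
  have "T e = 0" using nonneg_has_sum_le_0D[OF T _ T_nonneg e] by simp
  then show g: "grad h1 e = grad h2 e"
    using deriv_strict_mono[of "grad h1 e" "grad h2 e"] T_eq[OF e] by fastforce
  then show "grad u1 e = grad u2 e" using geq[OF e] by simp
qed

section \<open>Existence\<close>

lemma orbit_act:
  assumes "g \<in> carrier G" "x \<in> X"
  shows "orbit G \<alpha> (\<alpha> g x) = orbit G \<alpha> x"
proof -
  have "\<alpha> h (\<alpha> g x) \<in> orbit G \<alpha> x" if "h \<in> carrier G" for h
    using that assms composition_rule[of x h g] unfolding orbit_def
    by (intro CollectI exI[of _ "h \<otimes> g"]) auto
  moreover have "\<alpha> h x \<in> orbit G \<alpha> (\<alpha> g x)" if "h \<in> carrier G" for h
    using that assms composition_rule[of "\<alpha> g x" h "inv g"] act_closed[of g x] act_inv_act[of g x]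
    unfolding orbit_def
    by (intro CollectI exI[of _ "h \<otimes> inv g"]) auto
  ultimately show ?thesis unfolding orbit_def by blast
qed

text \<open>
  Convergence of the increments along generators gives convergence of
  \<open>v\<^sub>n(g\<inverse>x) - v\<^sub>n(x)\<close> for every \<open>g\<close>. The \<open>v\<^sub>n\<close> themselves need not converge, so they are
  normalized to vanish at a base point \<open>r x\<close> of the orbit of \<open>x\<close>; this does not change gradients.
\<close>
lemma grad_limit_integrable:
  fixes v :: "nat \<Rightarrow> 'x \<Rightarrow> real"
  assumes conv: "\<And>e. e \<in> edges \<Longrightarrow> convergent (\<lambda>n. grad (v n) e)"
  obtains u where "\<And>e. e \<in> edges \<Longrightarrow> (\<lambda>n. grad (v n) e) \<longlonglongrightarrow> grad u e"
proof -
  have path: "\<forall>x\<in>X. convergent (\<lambda>n. v n (\<alpha> (inv g) x) - v n x)" if "g \<in> carrier G" for g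
    using that
  proof (induction g rule: generating_induct)
    case one
    then show ?case by (simp add: act_one convergent_const)
  next
    case (gen s)
    then show ?case using conv[of "(_, s)"] by (simp add: grad_def)
  next
    case (mult g h)
    show ?case
    proof
      fix x assume x: "x \<in> X"
      have "convergent (\<lambda>n. (v n (\<alpha> (inv h) (\<alpha> (inv g) x)) - v n (\<alpha> (inv g) x)) +
          (v n (\<alpha> (inv g) x) - v n x))"
        using mult x by (intro convergent_add) (auto simp: act_closed)
      then show "convergent (\<lambda>n. v n (\<alpha> (inv (g \<otimes> h)) x) - v n x)"
        using mult x by (simp add: act_inv_mult)
    qed
  qed
  define r where "r x = (SOME y. y \<in> orbit G \<alpha> x)" for x
  define u where "u x = lim (\<lambda>n. v n x - v n (r x))" for x
  have u: "(\<lambda>n. v n x - v n (r x)) \<longlonglongrightarrow> u x" if x: "x \<in> X" for x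
  proof -
    have "r x \<in> orbit G \<alpha> x" unfolding r_def using orbit_refl[OF x] by (rule someI)
    then obtain g where g: "g \<in> carrier G" "r x = \<alpha> g x" unfolding orbit_def by blast
    then have "convergent (\<lambda>n. v n (r x) - v n x)" using path[of "inv g"] x by simp
    then have "convergent (\<lambda>n. v n x - v n (r x))"
      using convergent_minus_iff[of "\<lambda>n. v n (r x) - v n x"] by simp
    then show ?thesis unfolding u_def by (simp add: convergent_LIMSEQ_iff)
  qed
  have "(\<lambda>n. grad (v n) e) \<longlonglongrightarrow> grad u e" if "e \<in> edges" for e
  proof -
    obtain x s where e: "e = (x, s)" "x \<in> X" "s \<in> S" using \<open>e \<in> edges\<close> by auto
    have s: "inv s \<in> carrier G" using e S_carrier by simp
    have "r (\<alpha> (inv s) x) = r x" unfolding r_def using orbit_act[OF s] e by simp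
    then have "(\<lambda>n. (v n (\<alpha> (inv s) x) - v n (r x)) - (v n x - v n (r x))) \<longlonglongrightarrow>
        u (\<alpha> (inv s) x) - u x"
      using u[of "\<alpha> (inv s) x"] u[of x] act_closed[OF s] e by (intro tendsto_diff) auto
    then show ?thesis by (simp add: grad_def e)
  qed
  then show ?thesis using that by blast
qed

lemma finite_support_grad_indicator:
  assumes "x0 \<in> X"
  shows "finite {e \<in> edges. grad (indicator {x0}) e \<noteq> 0}"
proof (rule finite_subset)
  show "{e \<in> edges. grad (indicator {x0}) e \<noteq> 0} \<subseteq> ((\<lambda>s. \<alpha> s x0) ` S \<union> {x0}) \<times> S"
  proof
    fix e assume "e \<in> {e \<in> edges. grad (indicator {x0}) e \<noteq> 0}"
    then obtain x s where e: "e = (x, s)" "x \<in> X" "s \<in> S" "grad (indicator {x0}) (x, s) \<noteq> 0"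
      by auto
    then have "x = x0 \<or> \<alpha> (inv s) x = x0" by (auto simp: grad_def indicator_def split: if_splits)
    then show "e \<in> ((\<lambda>s. \<alpha> s x0) ` S \<union> {x0}) \<times> S"
      using e act_act_inv[OF S_carrier, of s x] by force
  qed
qed (use finite_S in auto)

text \<open>
  Perturbing \<open>w\<^sub>n\<close> by a multiple \<open>t \<delta>\<close> of the indicator of a point changes the gradient only on a
  finite edge set \<open>F\<close>, and lowers the modular by at most \<open>\<rho>(\<nabla>w\<^sub>n) - m\<close>, which tends to zero. In the
  limit \<open>t = 0\<close> minimizes the sum of \<open>\<Phi>(\<nabla>h + t \<nabla>\<delta>)\<close> over \<open>F\<close>. Continuity of the modular is not
  an issue, because only finitely many edges take part.
\<close>
lemma harmonicI_of_minimizing_sequence: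
  assumes h: "h \<in> Dirichlet_space \<Phi> G X \<alpha>"
    and w: "\<And>n. finite_energy edges (grad (w n))"
    and lim: "\<And>e. e \<in> edges \<Longrightarrow> (\<lambda>n. grad (w n) e) \<longlonglongrightarrow> grad h e"
    and energy: "(\<lambda>n. energy edges (grad (w n))) \<longlonglongrightarrow> m"
    and min: "\<And>n v. v \<in> Orlicz_space \<Phi> X \<Longrightarrow> m \<le> energy edges (grad (\<lambda>x. w n x + v x))"
  shows "h \<in> Phi_harmonic \<Phi> G S X \<alpha>"
proof -
  have "Phi_Laplacian \<Phi> G S \<alpha> h x0 = 0" if x0: "x0 \<in> X" for x0
  proof -
    define \<delta> :: "'x \<Rightarrow> real" where "\<delta> = indicator {x0}"
    define F where "F = {e \<in> edges. grad \<delta> e \<noteq> 0}"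
    have F: "finite F" "F \<subseteq> edges"
      using finite_support_grad_indicator[OF x0] by (auto simp: F_def \<delta>_def)
    have "(\<lambda>x. \<Phi> (\<delta> x)) summable_on X"
      by (rule finite_nonzero_values_imp_summable_on)
        (auto simp: \<delta>_def indicator_def intro: finite_subset[of _ "{x0}"])
    then have \<delta>: "finite_energy X \<delta>" by (simp add: finite_energy_def)
    have ge: "(\<Sum>e\<in>F. \<Phi> (grad h e)) \<le> (\<Sum>e\<in>F. \<Phi> (grad h e + t * grad \<delta> e))" for t
    proof -
      define wt where "wt n = (\<lambda>x. w n x + t * \<delta> x)" for n
      have gwt: "grad (wt n) e = grad (w n) e + t * grad \<delta> e" for n e
        by (simp add: wt_def grad_def case_prod_unfold algebra_simps)
      have fwt: "finite_energy edges (grad (wt n))" for n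
        unfolding gwt
        using finite_energy_add[OF w finite_energy_scale[OF finite_energy_grad[OF \<delta>]]]
        by (simp add: gwt[abs_def])
      have step: "m - energy edges (grad (w n)) \<le>
          (\<Sum>e\<in>F. \<Phi> (grad (w n) e + t * grad \<delta> e)) - (\<Sum>e\<in>F. \<Phi> (grad (w n) e))" for n
      proof -
        have "energy (edges - F) (grad (wt n)) = energy (edges - F) (grad (w n))"
          by (intro energy_cong) (auto simp: F_def gwt)
        moreover have "m \<le> energy edges (grad (wt n))"
          unfolding wt_def using finite_energy_scale[OF \<delta>, of t]
          by (intro min) (simp add: Orlicz_space_iff)
        ultimately show ?thesis
          using energy_split[OF fwt F, of n] energy_split[OF w F, of n] by (simp add: gwt)
      qed
      have "(\<lambda>n. m - energy edges (grad (w n))) \<longlonglongrightarrow> m - m"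
        by (intro tendsto_diff tendsto_const energy)
      moreover have "(\<lambda>n. (\<Sum>e\<in>F. \<Phi> (grad (w n) e + t * grad \<delta> e)) - (\<Sum>e\<in>F. \<Phi> (grad (w n) e)))
          \<longlonglongrightarrow> (\<Sum>e\<in>F. \<Phi> (grad h e + t * grad \<delta> e)) - (\<Sum>e\<in>F. \<Phi> (grad h e))"
        using F by (intro tendsto_diff tendsto_sum tendsto tendsto_add tendsto_const lim) auto
      ultimately have "m - m \<le> (\<Sum>e\<in>F. \<Phi> (grad h e + t * grad \<delta> e)) - (\<Sum>e\<in>F. \<Phi> (grad h e))"
        by (rule LIMSEQ_le) (use step in auto)
      then show ?thesis by simp
    qed
    have "((\<lambda>t. \<Sum>e\<in>F. \<Phi> (grad h e + t * grad \<delta> e)) has_real_derivative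
        (\<Sum>e\<in>F. deriv \<Phi> (grad h e + 0 * grad \<delta> e) * grad \<delta> e)) (at 0)"
      by (intro DERIV_sum DERIV_chain2[OF deriv]) (auto intro!: derivative_eq_intros)
    then have "(\<Sum>e\<in>F. deriv \<Phi> (grad h e + 0 * grad \<delta> e) * grad \<delta> e) = 0"
      by (rule DERIV_local_min[where d = 1]) (use ge in auto)
    moreover have "(\<Sum>\<^sub>\<infinity>e\<in>edges. deriv \<Phi> (grad h e) * grad \<delta> e) =
        (\<Sum>\<^sub>\<infinity>e\<in>F. deriv \<Phi> (grad h e) * grad \<delta> e)"
      by (rule infsum_cong_neutral) (auto simp: F_def)
    ultimately have "(\<Sum>\<^sub>\<infinity>e\<in>edges. deriv \<Phi> (grad h e) * grad \<delta> e) = 0" using F by simp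
    then have "(\<Sum>\<^sub>\<infinity>x\<in>X. Phi_Laplacian \<Phi> G S \<alpha> h x * \<delta> x) = 0"
      using summation_by_parts[OF h, of \<delta>] \<delta> by (simp add: Orlicz_space_iff)
    moreover have "(\<Sum>\<^sub>\<infinity>x\<in>X. Phi_Laplacian \<Phi> G S \<alpha> h x * \<delta> x) =
        (\<Sum>\<^sub>\<infinity>x\<in>{x0}. Phi_Laplacian \<Phi> G S \<alpha> h x * \<delta> x)"
      using x0 by (intro infsum_cong_neutral) (auto simp: \<delta>_def)
    ultimately show ?thesis by (simp add: \<delta>_def)
  qed
  then show ?thesis using h unfolding Phi_harmonic_def by blast
qed

text \<open>
  Banach--Saks for the differences \<open>\<nabla>u - \<nabla>v\<^sub>n\<close>: an average of gradients of the \<open>v\<^sub>n\<close> is the gradient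
  of their average, which again belongs to the Orlicz space.
\<close>
lemma Orlicz_closureI_of_pointwise_limit:
  fixes v :: "nat \<Rightarrow> 'x \<Rightarrow> real"
  assumes v: "\<And>n. v n \<in> Orlicz_space \<Phi> X" and u: "u \<in> Dirichlet_space \<Phi> G X \<alpha>"
    and bound: "\<And>n. energy edges (\<lambda>e. grad u e - grad (v n) e) \<le> R"
    and lim: "\<And>e. e \<in> edges \<Longrightarrow> (\<lambda>n. grad (v n) e) \<longlonglongrightarrow> grad u e"
  shows "u \<in> Orlicz_closure \<Phi> G S X \<alpha>"
proof -
  have fin: "finite_energy edges (\<lambda>e. grad u e - grad (v n) e)" for n
    using v u finite_energy_grad[of "v n"]
    by (intro finite_energy_diff) (auto simp: Dirichlet_space_iff Orlicz_space_iff)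
  have "\<exists>V\<in>Orlicz_space \<Phi> X. Dirichlet_seminorm \<Phi> G S X \<alpha> (\<lambda>x. u x - V x) < \<epsilon>"
    if \<epsilon>: "\<epsilon> > 0" for \<epsilon>
  proof -
    \<comment> \<open>Each of the \<open>card S\<close> slices gets gauge norm at most \<open>k\<close>; the 1 makes
      the total strictly smaller than \<open>\<epsilon>\<close> and covers empty \<open>S\<close>.\<close>
    define k where "k = \<epsilon> / (card S + 1)"
    have k: "k > 0" using \<epsilon> by (simp add: k_def)
    define b where "b n e = 1 / k * (grad u e - grad (v n) e)" for n e
    obtain R' where R': "\<And>w. finite_energy edges w \<Longrightarrow> energy edges w \<le> R \<Longrightarrow>
        finite_energy edges (\<lambda>e. 1 / k * w e) \<and> energy edges (\<lambda>e. 1 / k * w e) \<le> R'"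
      using energy_scale_bounded by blast
    have b: "finite_energy edges (b n)" "energy edges (b n) \<le> R'" for n
      using R'[OF fin bound] by (auto simp: b_def[abs_def])
    have blim: "(\<lambda>n. b n e) \<longlonglongrightarrow> 0" if "e \<in> edges" for e
      unfolding b_def
      using tendsto_mult[OF tendsto_const[of "1 / k"] tendsto_diff[OF tendsto_const[of "grad u e"] lim[OF that]]]
      by simp
    obtain N :: nat and j :: "nat \<Rightarrow> nat"
      where N: "N > 0" "energy edges (\<lambda>e. (\<Sum>l<N. b (j l) e) / N) \<le> 1"
      using energy_Banach_Saks[OF b blim, of 1] by auto
    define V where "V x = 1 / N * (\<Sum>l<N. v (j l) x)" for x
    have V: "V \<in> Orlicz_space \<Phi> X"
      unfolding V_def[abs_def] Orlicz_space_iff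
      using v by (intro finite_energy_scale finite_energy_sum) (simp add: Orlicz_space_iff)
    have "grad V e = 1 / N * (\<Sum>l<N. grad (v (j l)) e)" for e
      by (simp add: V_def grad_def case_prod_unfold sum_subtractf right_diff_distrib diff_divide_distrib)
    then have avg: "(\<Sum>l<N. b (j l) e) / N = grad (\<lambda>x. u x - V x) e / k" for e
      using N k by (simp add: b_def grad_diff sum_subtractf sum_divide_distrib[symmetric] field_simps)
    have fin_avg: "finite_energy edges (\<lambda>e. grad (\<lambda>x. u x - V x) e / k)"
      unfolding avg[symmetric]
      using finite_energy_scale[OF finite_energy_sum[of "{..<N}" edges "\<lambda>l. b (j l)"], of "1 / N"] b(1)
      by simp
    have "gauge_norm \<Phi> X (\<lambda>x. grad (\<lambda>x. u x - V x) (x, s)) \<le> k" if "s \<in> S" for s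
      using energy_slice_le[OF fin_avg that] N(2) k by (intro gauge_norm_le) (auto simp: avg)
    then have "Dirichlet_seminorm \<Phi> G S X \<alpha> (\<lambda>x. u x - V x) \<le> card S * k"
      unfolding Dirichlet_seminorm_def translate_def
      by (intro sum_bounded_above) (simp add: grad_def)
    also have "\<dots> < \<epsilon>" using \<epsilon> by (simp add: k_def field_simps)
    finally show ?thesis using V by blast
  qed
  then show ?thesis using u unfolding Orlicz_closure_def by blast
qed

lemma minimizing_sequence_exists:
  assumes f: "f \<in> Dirichlet_space \<Phi> G X \<alpha>"
  obtains v :: "nat \<Rightarrow> 'x \<Rightarrow> real" and m
  where "\<forall>n. v n \<in> Orlicz_space \<Phi> X"
    "\<forall>V\<in>Orlicz_space \<Phi> X. m \<le> energy edges (grad (\<lambda>x. f x - V x))"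
    "(\<lambda>n. energy edges (grad (\<lambda>x. f x - v n x))) \<longlonglongrightarrow> m"
proof -
  define J where "J V = energy edges (grad (\<lambda>x. f x - V x))" for V
  define m where "m = Inf (J ` Orlicz_space \<Phi> X)"
  have bdd: "bdd_below (J ` Orlicz_space \<Phi> X)"
    using energy_nonneg by (auto simp: J_def intro!: bdd_belowI[of _ 0])
  have ne: "J ` Orlicz_space \<Phi> X \<noteq> {}" using finite_energy_0[of X] Orlicz_space_iff by blast
  have m: "m \<le> J V" if "V \<in> Orlicz_space \<Phi> X" for V
    unfolding m_def using that bdd by (intro cInf_lower) auto
  have "\<exists>V. V \<in> Orlicz_space \<Phi> X \<and> J V < m + 1 / Suc n" for n
    using cInf_lessD[OF ne, of "m + 1 / Suc n"] unfolding m_def by auto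
  then obtain v where v: "\<And>n. v n \<in> Orlicz_space \<Phi> X" "\<And>n. J (v n) < m + 1 / Suc n" by metis
  have "(\<lambda>n. J (v n)) \<longlonglongrightarrow> m"
  proof (rule tendsto_sandwich[where f = "\<lambda>_. m" and h = "\<lambda>n. m + 1 / Suc n"])
    show "(\<lambda>n. m + 1 / Suc n) \<longlonglongrightarrow> m"
      using tendsto_add[OF tendsto_const[of m] LIMSEQ_inverse_real_of_nat]
      by (simp add: inverse_eq_divide)
    show "\<forall>\<^sub>F n in sequentially. J (v n) \<le> m + 1 / Suc n"
      using v(2) by (intro always_eventually allI less_imp_le)
  qed (use m v(1) in auto)
  then show ?thesis using that[of v m] v(1) m by (simp add: J_def)
qed

lemma decomposition_exists:
  assumes f: "f \<in> Dirichlet_space \<Phi> G X \<alpha>"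
  shows "\<exists>u\<in>Orlicz_closure \<Phi> G S X \<alpha>. \<exists>h\<in>Phi_harmonic \<Phi> G S X \<alpha>. \<forall>x\<in>X. f x = u x + h x"
proof -
  obtain v :: "nat \<Rightarrow> 'x \<Rightarrow> real" and m
  where "\<forall>n. v n \<in> Orlicz_space \<Phi> X"
    and "\<forall>V\<in>Orlicz_space \<Phi> X. m \<le> energy edges (grad (\<lambda>x. f x - V x))"
    and to_m: "(\<lambda>n. energy edges (grad (\<lambda>x. f x - v n x))) \<longlonglongrightarrow> m"
    by (rule minimizing_sequence_exists[OF f])
  then have v: "v n \<in> Orlicz_space \<Phi> X"
    and m: "V \<in> Orlicz_space \<Phi> X \<Longrightarrow> m \<le> energy edges (grad (\<lambda>x. f x - V x))" for n V
    by blast+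
  define w where "w n = (\<lambda>x. f x - v n x)" for n
  have gw: "grad (w n) e = grad f e - grad (v n) e" for n e by (simp add: w_def grad_diff)
  have fv: "finite_energy X (v n)" for n using v by (simp add: Orlicz_space_iff)
  have gf: "finite_energy edges (grad f)" using f by (simp add: Dirichlet_space_iff)
  have fw: "finite_energy edges (grad (w n))" for n
    unfolding gw[abs_def] by (intro finite_energy_diff gf finite_energy_grad fv)
  have to_m': "(\<lambda>n. energy edges (grad (w n))) \<longlonglongrightarrow> m" using to_m by (simp add: w_def)
  have mid: "m \<le> energy edges (\<lambda>e. (grad (w n) e + grad (w k) e) / 2)" for n k
  proof -
    have "(\<lambda>x. 1 / 2 * (v n x + v k x)) \<in> Orlicz_space \<Phi> X"
      unfolding Orlicz_space_iff by (intro finite_energy_scale finite_energy_add fv)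
    from m[OF this] have "m \<le> energy edges (grad (\<lambda>x. f x - 1 / 2 * (v n x + v k x)))" .
    also have "grad (\<lambda>x. f x - 1 / 2 * (v n x + v k x)) = (\<lambda>e. (grad (w n) e + grad (w k) e) / 2)"
      by (rule ext) (simp add: w_def grad_def case_prod_unfold field_simps)
    finally show ?thesis .
  qed
  have "convergent (\<lambda>n. grad (v n) e)" if "e \<in> edges" for e
  proof -
    have "convergent (\<lambda>n. grad (w n) e)"
      using minimizing_sequence_Cauchy[OF fw to_m' mid that] by (simp add: Cauchy_convergent_iff)
    then have "convergent (\<lambda>n. grad f e - grad (w n) e)"
      by (intro convergent_diff convergent_const)
    then show ?thesis by (simp add: gw)
  qed
  then obtain u where u: "\<And>e. e \<in> edges \<Longrightarrow> (\<lambda>n. grad (v n) e) \<longlonglongrightarrow> grad u e"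
    using grad_limit_integrable[of v] by blast
  define h where "h = (\<lambda>x. f x - u x)"
  have gh: "grad h e = grad f e - grad u e" for e by (simp add: h_def grad_diff)
  have lim: "(\<lambda>n. grad (w n) e) \<longlonglongrightarrow> grad h e" if "e \<in> edges" for e
    unfolding gw gh by (intro tendsto_diff tendsto_const u that)
  obtain R where R: "\<And>n. energy edges (grad (w n)) \<le> R"
    using convergent_imp_Bseq[OF convergentI[OF to_m']] by (metis BseqE abs_le_D1 real_norm_def)
  have fh: "finite_energy edges (grad h)" using energy_Fatou(1)[OF fw R lim] .
  then have h: "h \<in> Dirichlet_space \<Phi> G X \<alpha>" by (simp add: Dirichlet_space_iff)
  have gu: "grad u e = grad f e - grad h e" for e by (simp add: gh)
  have uD: "u \<in> Dirichlet_space \<Phi> G X \<alpha>"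
    unfolding Dirichlet_space_iff gu[abs_def] by (intro finite_energy_diff gf fh)
  have "h \<in> Phi_harmonic \<Phi> G S X \<alpha>"
  proof (rule harmonicI_of_minimizing_sequence[OF h fw lim to_m'])
    fix n V assume "V \<in> Orlicz_space \<Phi> X"
    then have "(\<lambda>x. v n x - V x) \<in> Orlicz_space \<Phi> X"
      unfolding Orlicz_space_iff by (intro finite_energy_diff fv)
    from m[OF this] show "m \<le> energy edges (grad (\<lambda>x. w n x + V x))"
      by (simp add: w_def algebra_simps)
  qed
  moreover have "u \<in> Orlicz_closure \<Phi> G S X \<alpha>"
  proof -
    obtain R2 where R2: "\<And>w. finite_energy edges w \<Longrightarrow> energy edges w \<le> R \<Longrightarrow>
        finite_energy edges (\<lambda>e. 2 * w e) \<and> energy edges (\<lambda>e. 2 * w e) \<le> R2"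
      using energy_scale_bounded by blast
    have "energy edges (\<lambda>e. grad u e - grad (v n) e) \<le> (R2 + energy edges (\<lambda>e. 2 * - grad h e)) / 2" for n
    proof -
      have "energy edges (\<lambda>e. grad (w n) e + - grad h e) \<le>
          (energy edges (\<lambda>e. 2 * grad (w n) e) + energy edges (\<lambda>e. 2 * - grad h e)) / 2"
        by (intro energy_add_le(2) fw finite_energy_minus fh)
      also have "\<dots> \<le> (R2 + energy edges (\<lambda>e. 2 * - grad h e)) / 2"
        using R2[OF fw R, of n] by simp
      finally show ?thesis by (simp add: gw gh)
    qed
    then show ?thesis by (rule Orlicz_closureI_of_pointwise_limit[OF v uD _ u])
  qed
  moreover have "\<forall>x\<in>X. f x = u x + h x" by (simp add: h_def)
  ultimately show ?thesis by blast
qed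

end

lemma N_function_even_zero:
  assumes "N_function \<Phi>"
  shows "\<Phi> (- x) = \<Phi> x" "\<Phi> 0 = 0"
proof -
  obtain \<phi> :: "real \<Rightarrow> real" where \<phi>: "\<And>x. (\<phi> has_integral \<Phi> x) {0..\<bar>x\<bar>}"
    using assms unfolding N_function_def by blast
  show "\<Phi> (- x) = \<Phi> x"
    using has_integral_unique[of \<phi> "\<Phi> (- x)" "{0..\<bar>x\<bar>}" "\<Phi> x"] \<phi>[of x] \<phi>[of "- x"] by simp
  show "\<Phi> 0 = 0"
    using has_integral_unique[of \<phi> "\<Phi> 0" "{0}" 0] \<phi>[of 0] has_integral_refl(2)[of \<phi> "0::real"] by simp
qed

theorem theorem3p6:
  fixes \<Phi> :: "real \<Rightarrow> real"
    and G :: "('g, 'm) monoid_scheme"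
    and S :: "'g set"
    and X :: "'x set"
    and \<alpha> :: "'g \<Rightarrow> 'x \<Rightarrow> 'x"
    and f :: "'x \<Rightarrow> real"
  assumes "N_function \<Phi>"
    and "\<Phi> C1_differentiable_on UNIV"
    and "strictly_convex \<Phi>"
    and "Delta2_zero \<Phi>"
    and "Nabla2_zero \<Phi>"
    and "group G"
    and "finite S"
    and "symmetric_generating_set G S"
    and "countable X"
    and "group_action G X \<alpha>"
    and "f \<in> Dirichlet_space \<Phi> G X \<alpha>"
  shows "(\<exists>u\<in>Orlicz_closure \<Phi> G S X \<alpha>. \<exists>h\<in>Phi_harmonic \<Phi> G S X \<alpha>.
            \<forall>x\<in>X. f x = u x + h x) \<and>
         (\<forall>u1\<in>Orlicz_closure \<Phi> G S X \<alpha>. \<forall>h1\<in>Phi_harmonic \<Phi> G S X \<alpha>.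
          \<forall>u2\<in>Orlicz_closure \<Phi> G S X \<alpha>. \<forall>h2\<in>Phi_harmonic \<Phi> G S X \<alpha>.
            (\<forall>x\<in>X. f x = u1 x + h1 x) \<longrightarrow> (\<forall>x\<in>X. f x = u2 x + h2 x) \<longrightarrow>
            (\<lambda>x. u1 x - u2 x) \<in> Dirichlet_invariants \<Phi> G X \<alpha> \<and>
            (\<lambda>x. h1 x - h2 x) \<in> Dirichlet_invariants \<Phi> G X \<alpha>)"
proof -
  have deriv: "(\<Phi> has_real_derivative deriv \<Phi> x) (at x)" for x
    using assms(2) unfolding C1_differentiable_on_def
    by (metis DERIV_imp_deriv UNIV_I has_real_derivative_iff_has_vector_derivative)
  interpret young_function \<Phi>
    by (rule young_function.intro) (rule N_function_even_zero[OF assms(1)] assms deriv)+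
  interpret group_action G X \<alpha> by fact
  interpret orlicz_action \<Phi> G X \<alpha> S by unfold_locales fact+
  have "(\<lambda>x. u1 x - u2 x) \<in> Dirichlet_invariants \<Phi> G X \<alpha> \<and>
      (\<lambda>x. h1 x - h2 x) \<in> Dirichlet_invariants \<Phi> G X \<alpha>"
    if "u1 \<in> Orlicz_closure \<Phi> G S X \<alpha>" "h1 \<in> Phi_harmonic \<Phi> G S X \<alpha>"
      "u2 \<in> Orlicz_closure \<Phi> G S X \<alpha>" "h2 \<in> Phi_harmonic \<Phi> G S X \<alpha>"
      and eq: "\<forall>x\<in>X. f x = u1 x + h1 x" "\<forall>x\<in>X. f x = u2 x + h2 x"
    for u1 h1 u2 h2
  proof -
    have "grad h1 e = grad h2 e" "grad u1 e = grad u2 e" if "e \<in> edges" for e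
      using decomposition_grad_unique[of u1 u2 h1 h2 e] that \<open>u1 \<in> _\<close> \<open>u2 \<in> _\<close> \<open>h1 \<in> _\<close> \<open>h2 \<in> _\<close> eq
      by auto
    then show ?thesis by (intro conjI grad_eq_0_imp_Dirichlet_invariants) (simp_all add: grad_diff)
  qed
  then show ?thesis using decomposition_exists[OF assms(11)] by blast
qed

end
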